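(* Let $n\ge 1$ and let $g$ be the Semi-Riemannian metric on $GL_n=GL_n(\mathbb{R})$ given by $g_A(V,W)=\mathrm{tr}(A^{-1}VA^{-1}W)$ for $A\in GL_n$, $V,W\in T_A(GL_n)=M_n(\mathbb{R})$. 1) The following maps of $GL_n$ to itself, and all their compositions, are isometries of $(GL_n,g)$: the left translations $L_G(X)=GX$, the right translations $R_G(X)=XG$, the conjugacies $C_G(X)=G^{-1}XG$, the congruences $\Gamma_G(X)=G^TXG$ (for every $G\in GL_n$), the opposite $X\mapsto -X$, the inversion $\varphi(X)=X^{-1}$, and the transposition $\tau(X)=X^T$. 2) Both $(GL_n^+,g)$ and $(GL_n^-,g)$ are symmetric manifolds, and for any $A\in GL_n^+$ (respectively $A\in GL_n^-$) the symmetry with respect to $A$ is $\psi_A=R_A\circ L_A\circ\varphi=L_A\circ R_A\circ\varphi$. In particular $\psi_{I_n}=\varphi$.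
   Context: $GL_n^+$ and $GL_n^-$ are the two connected components of $GL_n(\mathbb{R})$, consisting of the matrices with positive, respectively negative, determinant, with the restricted metric $g$. A Semi-Riemannian (globally) symmetric space is a connected Semi-Riemannian manifold $M$ such that for each $p\in M$ there is a (unique) isometry $\zeta_p:M\to M$ fixing $p$ whose differential at $p$ is $-\mathrm{id}$ on $T_pM$; $\zeta_p$ is called the symmetry with respect to $p$. *)

theory Defs
  imports "HOL-Analysis.Analysis"
begin

section \<open>Semi-Riemannian geometry on open subsets of a Euclidean space\<close>

text \<open>
  All manifolds occurring here are open subsets \<open>M\<close> of a Euclidean space \<open>'a\<close>, with every
  tangent space identified with \<open>'a\<close>. A metric is a function \<open>g\<close> such that \<open>g p v w\<close> is the
  value of the metric at the point \<open>p\<close> on the tangent vectors \<open>v\<close> and \<open>w\<close>. A map of \<open>M\<close> to itself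
  is a total function of which only the restriction to \<open>M\<close> matters; since \<open>M\<close> is open,
  the derivative of the map at a point of \<open>M\<close> depends only on this restriction.
\<close>

primrec Ck_on ::
  "nat \<Rightarrow> 'a::real_normed_vector set \<Rightarrow> ('a \<Rightarrow> 'b::real_normed_vector) \<Rightarrow> bool" where
  "Ck_on 0 S f \<longleftrightarrow> continuous_on S f"
| "Ck_on (Suc k) S f \<longleftrightarrow>
     (\<forall>x\<in>S. f differentiable (at x)) \<and> (\<forall>v. Ck_on k S (\<lambda>x. frechet_derivative f (at x) v))"

text \<open>
  The derivative is taken with respect to the full neighbourhood filter, so this is the
  usual notion of smoothness for open \<open>S\<close> (and finite-dimensional domain) only.
\<close>

definition smooth_on ::
  "'a::real_normed_vector set \<Rightarrow> ('a \<Rightarrow> 'b::real_normed_vector) \<Rightarrow> bool" where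
  "smooth_on S f \<longleftrightarrow> (\<forall>k. Ck_on k S f)"

definition diffeomorphism_on ::
  "'a::real_normed_vector set \<Rightarrow> 'b::real_normed_vector set \<Rightarrow> ('a \<Rightarrow> 'b) \<Rightarrow> bool" where
  "diffeomorphism_on M N f \<longleftrightarrow>
     bij_betw f M N \<and> smooth_on M f \<and> smooth_on N (inv_into M f)"

definition symmetric_form :: "('a \<Rightarrow> 'a \<Rightarrow> real) \<Rightarrow> bool" where
  "symmetric_form b \<longleftrightarrow> (\<forall>v w. b v w = b w v)"

definition nondegenerate_form :: "('a::real_vector \<Rightarrow> 'a \<Rightarrow> real) \<Rightarrow> bool" where
  "nondegenerate_form b \<longleftrightarrow> (\<forall>v. (\<forall>w. b v w = 0) \<longrightarrow> v = 0)"

text \<open>The largest dimension of a subspace on which the form is negative definite.\<close>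

definition form_index :: "('a::euclidean_space \<Rightarrow> 'a \<Rightarrow> real) \<Rightarrow> nat" where
  "form_index b = Max {dim W |W. subspace W \<and> (\<forall>v\<in>W. v \<noteq> 0 \<longrightarrow> b v v < 0)}"

definition semi_riemannian_manifold ::
  "'a::euclidean_space set \<Rightarrow> ('a \<Rightarrow> 'a \<Rightarrow> 'a \<Rightarrow> real) \<Rightarrow> bool" where
  "semi_riemannian_manifold M g \<longleftrightarrow>
     open M \<and>
     (\<forall>p\<in>M. bilinear (g p) \<and> symmetric_form (g p) \<and> nondegenerate_form (g p)) \<and>
     (\<forall>v w. smooth_on M (\<lambda>p. g p v w)) \<and>
     (\<exists>\<nu>. \<forall>p\<in>M. form_index (g p) = \<nu>)"

definition isometry_of ::
  "'a::euclidean_space set \<Rightarrow> ('a \<Rightarrow> 'a \<Rightarrow> 'a \<Rightarrow> real) \<Rightarrow> ('a \<Rightarrow> 'a) \<Rightarrow> bool" where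
  "isometry_of M g f \<longleftrightarrow>
     diffeomorphism_on M M f \<and>
     (\<forall>p\<in>M. \<forall>v w. g (f p) (frechet_derivative f (at p) v) (frechet_derivative f (at p) w)
                    = g p v w)"

definition symmetry_at ::
  "'a::euclidean_space set \<Rightarrow> ('a \<Rightarrow> 'a \<Rightarrow> 'a \<Rightarrow> real) \<Rightarrow> 'a \<Rightarrow> ('a \<Rightarrow> 'a) \<Rightarrow> bool" where
  "symmetry_at M g p f \<longleftrightarrow>
     isometry_of M g f \<and> f p = p \<and> (\<forall>v. frechet_derivative f (at p) v = - v)"

text \<open>
  The symmetry is required to be unique as a map on \<open>M\<close>, that is, up to its irrelevant
  values outside \<open>M\<close>.
\<close>

definition semi_riemannian_symmetric_space ::
  "'a::euclidean_space set \<Rightarrow> ('a \<Rightarrow> 'a \<Rightarrow> 'a \<Rightarrow> real) \<Rightarrow> bool" where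
  "semi_riemannian_symmetric_space M g \<longleftrightarrow>
     semi_riemannian_manifold M g \<and> connected M \<and>
     (\<forall>p\<in>M. \<exists>f. symmetry_at M g p f \<and>
        (\<forall>f'. symmetry_at M g p f' \<longrightarrow> (\<forall>x\<in>M. f' x = f x)))"


section \<open>The general linear group with the trace metric\<close>

definition GL :: "(real^'n^'n) set" where
  "GL = {A. invertible A}"

definition GL_pos :: "(real^'n^'n) set" where
  "GL_pos = {A \<in> GL. det A > 0}"

definition GL_neg :: "(real^'n^'n) set" where
  "GL_neg = {A \<in> GL. det A < 0}"

definition trace_metric :: "real^'n^'n \<Rightarrow> real^'n^'n \<Rightarrow> real^'n^'n \<Rightarrow> real" where
  "trace_metric A V W = trace (matrix_inv A ** V ** matrix_inv A ** W)"

definition left_translation :: "real^'n^'n \<Rightarrow> real^'n^'n \<Rightarrow> real^'n^'n" where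
  "left_translation G X = G ** X"

definition right_translation :: "real^'n^'n \<Rightarrow> real^'n^'n \<Rightarrow> real^'n^'n" where
  "right_translation G X = X ** G"

definition conjugacy :: "real^'n^'n \<Rightarrow> real^'n^'n \<Rightarrow> real^'n^'n" where
  "conjugacy G X = matrix_inv G ** X ** G"

definition congruence :: "real^'n^'n \<Rightarrow> real^'n^'n \<Rightarrow> real^'n^'n" where
  "congruence G X = transpose G ** X ** G"

definition basic_maps :: "(real^'n^'n \<Rightarrow> real^'n^'n) set" where
  "basic_maps =
     left_translation ` GL \<union> right_translation ` GL \<union> conjugacy ` GL \<union> congruence ` GL \<union>
     {uminus, matrix_inv, transpose}"

inductive_set compositions :: "('a \<Rightarrow> 'a) set \<Rightarrow> ('a \<Rightarrow> 'a) set" for F where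
  base: "f \<in> F \<Longrightarrow> f \<in> compositions F"
| comp: "f \<in> compositions F \<Longrightarrow> h \<in> compositions F \<Longrightarrow> f \<circ> h \<in> compositions F"

definition psi :: "real^'n^'n \<Rightarrow> real^'n^'n \<Rightarrow> real^'n^'n" where
  "psi A = right_translation A \<circ> left_translation A \<circ> matrix_inv"

end

theory Submission
  imports Defs
begin

text \<open>
  The maps in the first part are composed of translations, inversion and transposition, and these
  preserve the trace form. An isometry satisfies a second-order
  differential equation (it preserves the Levi-Civita connection, here given by
  \<open>(U A\<^sup>-\<^sup>1 V + V A\<^sup>-\<^sup>1 U) / 2\<close> up to sign); hence two isometries with the same value and
  differential at one point agree locally, and by connectedness everywhere. This gives the
  uniqueness of the symmetries. The components of the general linear group are connected
  because elementary matrices can be joined to the identity or to a hyperplane reflection.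
\<close>

section \<open>Smooth maps between open sets\<close>

text \<open>The isometries to be compared are arbitrary, so uniqueness cannot rely on formulas for
  them. It is reached without geodesics because the second-order equation is solved for the highest
  derivatives: a map together with its partial derivatives satisfies a first-order system whose
  right-hand side is locally Lipschitz, and the difference c of two solutions obeys |dc| <= K |c|
  near every point. This inequality makes the common zero set open. The equation itself rests on a
  special feature of the trace form: its derivative in direction U, evaluated on V and W, is minus a
  trilinear form symmetric in all three arguments, so the Koszul computation collapses to one
  identity. For existence, the identity A (- A^-1 V A^-1) A = - V explains why psi_A has
  differential -id at A. For connectedness, elementary factors are joined inside the whole group;
  since the determinant has constant sign on a connected subset of the group, that sign then decides
  which component has been reached.\<close>

lemma Ck_on_SucD:
  assumes "Ck_on (Suc k) S f"
  shows "Ck_on k S f"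
  using assms
proof (induction k arbitrary: f)
  case 0
  then show ?case
    by (simp add: continuous_at_imp_continuous_on differentiable_imp_continuous_within)
next
  case (Suc k)
  then have "Ck_on (Suc k) S (\<lambda>x. frechet_derivative f (at x) v)" for v
    by simp
  with Suc show ?case
    by simp
qed

lemma smooth_on_imp_Ck_on: "smooth_on S f \<Longrightarrow> Ck_on k S f"
  by (simp add: smooth_on_def)

lemma smooth_on_frechet_derivative:
  assumes "smooth_on S f"
  shows "smooth_on S (\<lambda>x. frechet_derivative f (at x) v)"
  using smooth_on_imp_Ck_on[OF assms, of "Suc _"] unfolding smooth_on_def by simp

lemma smooth_on_has_derivative:
  assumes "smooth_on S f" "x \<in> S"
  shows "(f has_derivative frechet_derivative f (at x)) (at x)"
  using smooth_on_imp_Ck_on[OF assms(1), of "Suc 0"] assms(2) frechet_derivative_works[of f "at x"]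
  by simp

lemma smooth_on_continuous: "smooth_on S f \<Longrightarrow> continuous_on S f"
  using smooth_on_imp_Ck_on[of S f 0] by simp

lemma Ck_on_Suc_has_derivative:
  assumes "Ck_on (Suc k) S f" "x \<in> S"
  shows "(f has_derivative frechet_derivative f (at x)) (at x)"
  using assms frechet_derivative_works[of f "at x"] by simp

lemma Ck_on_mono: "S \<subseteq> T \<Longrightarrow> Ck_on k T f \<Longrightarrow> Ck_on k S f"
  by (induction k arbitrary: f) (auto intro: continuous_on_subset)

lemma smooth_on_mono: "S \<subseteq> T \<Longrightarrow> smooth_on T f \<Longrightarrow> smooth_on S f"
  by (auto simp: smooth_on_def intro: Ck_on_mono)

text \<open>Derivatives are taken with the full neighbourhood filter, so agreement on
  \<open>S\<close> passes to them because \<open>S\<close> is open.\<close>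

lemma Ck_on_eq:
  assumes "open S" "\<And>x. x \<in> S \<Longrightarrow> f x = g x" "Ck_on k S f"
  shows "Ck_on k S g"
  using assms(2,3)
proof (induction k arbitrary: f g)
  case 0
  then show ?case
    by (metis Ck_on.simps(1) continuous_on_cong)
next
  case (Suc k)
  have f: "\<And>x. x \<in> S \<Longrightarrow> f differentiable (at x)"
    and k: "\<And>v. Ck_on k S (\<lambda>x. frechet_derivative f (at x) v)"
    using Suc.prems(2) by auto
  have g: "(g has_derivative frechet_derivative f (at x)) (at x)" if "x \<in> S" for x
    using f[OF that] Suc.prems(1) that assms(1) frechet_derivative_works
    by (metis has_derivative_transform_within_open)
  have "frechet_derivative f (at x) = frechet_derivative g (at x)" if "x \<in> S" for x
    by (rule frechet_derivative_at[OF g[OF that]])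
  with Suc.IH[OF _ k] g show ?case
    by (auto simp: differentiable_def)
qed

lemma smooth_on_eq:
  "open S \<Longrightarrow> (\<And>x. x \<in> S \<Longrightarrow> f x = g x) \<Longrightarrow> smooth_on S f \<Longrightarrow> smooth_on S g"
  unfolding smooth_on_def using Ck_on_eq by blast

text \<open>Smoothness proofs for explicit formulas go through this rule: it replaces
  \<open>frechet_derivative\<close> by whatever derivative the calculus rules deliver.\<close>

lemma Ck_on_SucI:
  assumes "open S" "\<And>x. x \<in> S \<Longrightarrow> (f has_derivative f' x) (at x)"
    and "\<And>v. Ck_on k S (\<lambda>x. f' x v)"
  shows "Ck_on (Suc k) S f"
proof -
  have "f' x = frechet_derivative f (at x)" if "x \<in> S" for x
    by (rule frechet_derivative_at[OF assms(2)[OF that]])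
  then have "Ck_on k S (\<lambda>x. frechet_derivative f (at x) v)" for v
    by (intro Ck_on_eq[OF assms(1) _ assms(3)[of v]]) simp
  then show ?thesis
    using assms(2) by (auto simp: differentiable_def)
qed

lemma Ck_on_const: "Ck_on k S (\<lambda>x. c)"
  by (induction k arbitrary: c) auto

lemma Ck_on_bounded_linear:
  assumes "bounded_linear h"
  shows "Ck_on k S h"
proof (cases k)
  case 0
  then show ?thesis
    using assms by (simp add: linear_continuous_on)
next
  case (Suc k)
  then show ?thesis
    using frechet_derivative_at[OF bounded_linear_imp_has_derivative[OF assms], symmetric]
      bounded_linear_imp_differentiable[OF assms] Ck_on_const
    by auto
qed

lemma smooth_on_bounded_linear: "bounded_linear h \<Longrightarrow> smooth_on S h"
  by (simp add: smooth_on_def Ck_on_bounded_linear)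

lemma Ck_on_bounded_linear_compose:
  assumes "open S" "bounded_linear h" "Ck_on k S f"
  shows "Ck_on k S (\<lambda>x. h (f x))"
  using assms(3)
proof (induction k arbitrary: f)
  case 0
  then show ?case
    using assms(2) by (simp add: bounded_linear.continuous_on)
next
  case (Suc k)
  show ?case
  proof (rule Ck_on_SucI[OF assms(1)])
    fix x assume "x \<in> S"
    then have "(f has_derivative frechet_derivative f (at x)) (at x)"
      using Suc.prems Ck_on_Suc_has_derivative by blast
    then show "((\<lambda>x. h (f x)) has_derivative (\<lambda>v. h (frechet_derivative f (at x) v))) (at x)"
      by (rule bounded_linear.has_derivative[OF assms(2)])
  next
    fix v
    show "Ck_on k S (\<lambda>x. h (frechet_derivative f (at x) v))"
      using Suc by auto
  qed
qed

lemma Ck_on_add: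
  assumes "open S" "Ck_on k S f" "Ck_on k S g"
  shows "Ck_on k S (\<lambda>x. f x + g x)"
  using assms(2,3)
proof (induction k arbitrary: f g)
  case 0
  then show ?case
    by (simp add: continuous_on_add)
next
  case (Suc k)
  show ?case
  proof (rule Ck_on_SucI[OF assms(1)])
    fix x assume "x \<in> S"
    then have "(f has_derivative frechet_derivative f (at x)) (at x)"
      "(g has_derivative frechet_derivative g (at x)) (at x)"
      using Suc.prems Ck_on_Suc_has_derivative by blast+
    then show "((\<lambda>x. f x + g x) has_derivative
        (\<lambda>v. frechet_derivative f (at x) v + frechet_derivative g (at x) v)) (at x)"
      by (rule has_derivative_add)
  next
    fix v
    show "Ck_on k S (\<lambda>x. frechet_derivative f (at x) v + frechet_derivative g (at x) v)"
      using Suc by auto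
  qed
qed

lemma Ck_on_sum:
  assumes "open S" "\<And>i. i \<in> I \<Longrightarrow> Ck_on k S (f i)"
  shows "Ck_on k S (\<lambda>x. \<Sum>i\<in>I. f i x)"
  using assms(2)
  by (induction I rule: infinite_finite_induct) (auto intro: Ck_on_const Ck_on_add assms(1))

lemma Ck_on_bilinear:
  assumes "open S" "bounded_bilinear mul" "Ck_on k S f" "Ck_on k S g"
  shows "Ck_on k S (\<lambda>x. mul (f x) (g x))"
  using assms(3,4)
proof (induction k arbitrary: f g)
  case 0
  then show ?case
    using bounded_bilinear.continuous_on[OF assms(2)] by simp
next
  case (Suc k)
  show ?case
  proof (rule Ck_on_SucI[OF assms(1)])
    fix x assume "x \<in> S"
    then have "(f has_derivative frechet_derivative f (at x)) (at x)"
      "(g has_derivative frechet_derivative g (at x)) (at x)"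
      using Suc.prems Ck_on_Suc_has_derivative by blast+
    then show "((\<lambda>x. mul (f x) (g x)) has_derivative (\<lambda>v.
        mul (f x) (frechet_derivative g (at x) v) + mul (frechet_derivative f (at x) v) (g x))) (at x)"
      by (rule bounded_bilinear.FDERIV[OF assms(2)])
  next
    fix v
    have "Ck_on k S f" "Ck_on k S g"
      using Suc.prems by (auto intro: Ck_on_SucD)
    then show "Ck_on k S (\<lambda>x. mul (f x) (frechet_derivative g (at x) v)
        + mul (frechet_derivative f (at x) v) (g x))"
      using Suc by (intro Ck_on_add[OF assms(1)]) auto
  qed
qed

text \<open>\<open>Ck_on\<close> controls derivatives in fixed directions only, whereas the chain
  rule evaluates the derivative of \<open>g\<close> in a direction that moves with \<open>x\<close>.
  Expanding that direction in the basis of the middle space leaves products of fixed-direction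
  derivatives, to which the induction hypothesis applies.\<close>

lemma Ck_on_compose:
  fixes f :: "'a::real_normed_vector \<Rightarrow> 'b::euclidean_space"
    and g :: "'b \<Rightarrow> 'c::real_normed_vector"
  assumes "open S" "f ` S \<subseteq> T" "Ck_on k S f" "Ck_on k T g"
  shows "Ck_on k S (g \<circ> f)"
  using assms(3,4)
proof (induction k arbitrary: g)
  case 0
  then show ?case
    using assms(2) continuous_on_compose continuous_on_subset by (metis Ck_on.simps(1))
next
  case (Suc k)
  show ?case
  proof (rule Ck_on_SucI[OF assms(1)])
    fix x assume "x \<in> S"
    then have f: "(f has_derivative frechet_derivative f (at x)) (at x)"
      and g: "(g has_derivative frechet_derivative g (at (f x))) (at (f x))"
      using Suc.prems assms(2) Ck_on_Suc_has_derivative by blast+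
    have lin: "linear (frechet_derivative g (at (f x)))"
      using g has_derivative_linear by blast
    have rep: "frechet_derivative g (at (f x)) w
        = (\<Sum>b\<in>Basis. (w \<bullet> b) *\<^sub>R frechet_derivative g (at (f x)) b)" for w
    proof -
      have "frechet_derivative g (at (f x)) w
          = frechet_derivative g (at (f x)) (\<Sum>b\<in>Basis. (w \<bullet> b) *\<^sub>R b)"
        by (simp only: euclidean_representation)
      also have "\<dots> = (\<Sum>b\<in>Basis. (w \<bullet> b) *\<^sub>R frechet_derivative g (at (f x)) b)"
        by (simp only: linear_sum[OF lin] linear_cmul[OF lin])
      finally show ?thesis .
    qed
    have "frechet_derivative g (at (f x)) \<circ> frechet_derivative f (at x) = (\<lambda>v. \<Sum>b\<in>Basis.
        (frechet_derivative f (at x) v \<bullet> b) *\<^sub>R (((\<lambda>y. frechet_derivative g (at y) b) \<circ> f) x))"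
      by (rule ext) (simp only: o_apply rep[of "frechet_derivative f (at x) _"])
    with diff_chain_at[OF f g] show "((g \<circ> f) has_derivative (\<lambda>v. \<Sum>b\<in>Basis.
        (frechet_derivative f (at x) v \<bullet> b) *\<^sub>R (((\<lambda>y. frechet_derivative g (at y) b) \<circ> f) x))) (at x)"
      by simp
  next
    fix v
    have "Ck_on k S ((\<lambda>y. frechet_derivative g (at y) b) \<circ> f)" for b
      using Suc.prems(2) by (intro Suc.IH Ck_on_SucD[OF Suc.prems(1)]) simp
    moreover have "Ck_on k S (\<lambda>x. frechet_derivative f (at x) v \<bullet> b)" for b
      using Suc.prems(1)
      by (intro Ck_on_bounded_linear_compose[OF assms(1) bounded_linear_inner_left]) simp
    ultimately show "Ck_on k S (\<lambda>x. \<Sum>b\<in>Basis.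
        (frechet_derivative f (at x) v \<bullet> b) *\<^sub>R (((\<lambda>y. frechet_derivative g (at y) b) \<circ> f) x))"
      by (intro Ck_on_sum Ck_on_bilinear[OF assms(1) bounded_bilinear_scaleR] assms(1))
  qed
qed

lemma smooth_on_compose:
  fixes f :: "'a::real_normed_vector \<Rightarrow> 'b::euclidean_space"
  assumes "open S" "f ` S \<subseteq> T" "smooth_on S f" "smooth_on T g"
  shows "smooth_on S (g \<circ> f)"
  using assms Ck_on_compose unfolding smooth_on_def by blast

lemma smooth_on_bilinear:
  assumes "open S" "bounded_bilinear mul" "smooth_on S f" "smooth_on S g"
  shows "smooth_on S (\<lambda>x. mul (f x) (g x))"
  using assms Ck_on_bilinear unfolding smooth_on_def by blast

lemma smooth_on_bounded_linear_compose:
  assumes "open S" "bounded_linear h" "smooth_on S f"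
  shows "smooth_on S (\<lambda>x. h (f x))"
  using assms Ck_on_bounded_linear_compose unfolding smooth_on_def by blast

section \<open>Symmetry of second derivatives\<close>

text \<open>The mean value theorem is used twice: along \<open>u\<close> for the difference of
  \<open>f\<close> on two opposite sides of the parallelogram, then along \<open>v\<close> for the
  derivative found there.\<close>

lemma second_difference_mean_value:
  fixes f :: "'a::real_normed_vector \<Rightarrow> real"
  assumes "smooth_on S f" "0 < s"
    and in_S: "\<And>a b. \<lbrakk>0 \<le> a; a \<le> s; 0 \<le> b; b \<le> s\<rbrakk> \<Longrightarrow> x + a *\<^sub>R u + b *\<^sub>R v \<in> S"
  obtains a b where "0 \<le> a" "a \<le> s" "0 \<le> b" "b \<le> s"
    "f (x + s *\<^sub>R u + s *\<^sub>R v) - f (x + s *\<^sub>R u) - f (x + s *\<^sub>R v) + f x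
      = s * s * frechet_derivative (\<lambda>y. frechet_derivative f (at y) u) (at (x + a *\<^sub>R u + b *\<^sub>R v)) v"
proof -
  define F where "F = (\<lambda>y. frechet_derivative f (at y) u)"
  have path_u: "((\<lambda>a. f (x + a *\<^sub>R u + b *\<^sub>R v)) has_field_derivative F (x + a *\<^sub>R u + b *\<^sub>R v)) (at a)"
    if "0 \<le> a" "a \<le> s" "0 \<le> b" "b \<le> s" for a b
  proof -
    have *: "((\<lambda>a. x + a *\<^sub>R u + b *\<^sub>R v) has_derivative (\<lambda>h. h *\<^sub>R u)) (at a)"
      by (auto intro!: derivative_eq_intros)
    note f = smooth_on_has_derivative[OF assms(1) in_S[OF that]]
    have "linear (frechet_derivative f (at (x + a *\<^sub>R u + b *\<^sub>R v)))"
      using f has_derivative_linear by blast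
    then show ?thesis
      using diff_chain_at[OF * f] unfolding F_def has_field_derivative_def
      by (simp add: o_def linear_cmul mult_commute_abs)
  qed
  have "((\<lambda>a. f (x + a *\<^sub>R u + s *\<^sub>R v) - f (x + a *\<^sub>R u + 0 *\<^sub>R v)) has_field_derivative
      F (x + a *\<^sub>R u + s *\<^sub>R v) - F (x + a *\<^sub>R u + 0 *\<^sub>R v)) (at a)" if "0 \<le> a" "a \<le> s" for a
    using path_u[of a s] path_u[of a 0] that assms(2) by (intro DERIV_diff) auto
  from MVT2[OF assms(2) this] obtain a where a: "0 < a" "a < s" and
    fF: "f (x + s *\<^sub>R u + s *\<^sub>R v) - f (x + s *\<^sub>R u) - f (x + s *\<^sub>R v) + f x
      = s * (F (x + a *\<^sub>R u + s *\<^sub>R v) - F (x + a *\<^sub>R u + 0 *\<^sub>R v))"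
    by auto
  have "((\<lambda>b. F (x + a *\<^sub>R u + b *\<^sub>R v)) has_field_derivative
      frechet_derivative F (at (x + a *\<^sub>R u + b *\<^sub>R v)) v) (at b)" if "0 \<le> b" "b \<le> s" for b
  proof -
    have *: "((\<lambda>b. x + a *\<^sub>R u + b *\<^sub>R v) has_derivative (\<lambda>h. h *\<^sub>R v)) (at b)"
      by (auto intro!: derivative_eq_intros)
    have "x + a *\<^sub>R u + b *\<^sub>R v \<in> S"
      using a that by (intro in_S) auto
    note F = smooth_on_has_derivative[OF smooth_on_frechet_derivative[OF assms(1), of u, folded F_def] this]
    have "linear (frechet_derivative F (at (x + a *\<^sub>R u + b *\<^sub>R v)))"
      using F has_derivative_linear by blast
    then show ?thesis
      using diff_chain_at[OF * F] unfolding has_field_derivative_def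
      by (simp add: o_def linear_cmul mult_commute_abs)
  qed
  from MVT2[OF assms(2) this] obtain b where b: "0 < b" "b < s" and
    "F (x + a *\<^sub>R u + s *\<^sub>R v) - F (x + a *\<^sub>R u + 0 *\<^sub>R v)
      = s * frechet_derivative F (at (x + a *\<^sub>R u + b *\<^sub>R v)) v"
    by auto
  with fF have "f (x + s *\<^sub>R u + s *\<^sub>R v) - f (x + s *\<^sub>R u) - f (x + s *\<^sub>R v) + f x
      = s * s * frechet_derivative F (at (x + a *\<^sub>R u + b *\<^sub>R v)) v"
    by simp
  with a b that show ?thesis
    unfolding F_def by (metis less_imp_le)
qed

text \<open>The second difference of \<open>f\<close> does not depend on the order of
  \<open>u\<close> and \<open>v\<close>. It therefore equals s^2 times either mixed derivative at
  some point of a small parallelogram, and continuity forbids a gap between the two at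
  \<open>x\<close>.\<close>

lemma frechet_derivative_commute_real:
  fixes f :: "'a::real_normed_vector \<Rightarrow> real"
  assumes "open S" "smooth_on S f" "x \<in> S"
  shows "frechet_derivative (\<lambda>y. frechet_derivative f (at y) u) (at x) v
       = frechet_derivative (\<lambda>y. frechet_derivative f (at y) v) (at x) u"
proof (rule ccontr)
  define A where "A = (\<lambda>y. frechet_derivative (\<lambda>y. frechet_derivative f (at y) u) (at y) v)"
  define B where "B = (\<lambda>y. frechet_derivative (\<lambda>y. frechet_derivative f (at y) v) (at y) u)"
  \<comment> \<open>With half the gap as tolerance, values this close to \<open>A x\<close> and to
    \<open>B x\<close> cannot coincide.\<close>
  define \<epsilon> where "\<epsilon> = \<bar>A x - B x\<bar> / 2"
  assume "\<not> ?thesis"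
  then have "\<epsilon> > 0"
    by (simp add: \<epsilon>_def A_def B_def)
  have "continuous_on S A" "continuous_on S B"
    unfolding A_def B_def
    by (intro smooth_on_continuous smooth_on_frechet_derivative assms(2))+
  then have "isCont A x" "isCont B x"
    using assms(1,3) continuous_on_eq_continuous_at by blast+
  then obtain d1 d2 where d1: "d1 > 0" "\<And>y. dist y x < d1 \<Longrightarrow> dist (A y) (A x) < \<epsilon>"
    and d2: "d2 > 0" "\<And>y. dist y x < d2 \<Longrightarrow> dist (B y) (B x) < \<epsilon>"
    using \<open>\<epsilon> > 0\<close> unfolding continuous_at_eps_delta by metis
  obtain d3 where d3: "d3 > 0" "ball x d3 \<subseteq> S"
    using assms(1,3) open_contains_ball by blast
  define d where "d = min d1 (min d2 d3)"
  \<comment> \<open>This scale keeps the whole parallelogram strictly inside the ball of radius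
    \<open>d\<close>; the summand 1 covers the case that both directions vanish.\<close>
  define s where "s = d / (norm u + norm v + 1)"
  have "d > 0"
    using d1 d2 d3 by (simp add: d_def)
  have pos: "norm u + norm v + 1 > 0"
    by (smt (verit) norm_ge_zero)
  have "s > 0"
    using \<open>d > 0\<close> pos by (simp add: s_def)
  have near: "dist (x + a *\<^sub>R u + b *\<^sub>R v) x < d" if "0 \<le> a" "a \<le> s" "0 \<le> b" "b \<le> s" for a b
  proof -
    have "dist (x + a *\<^sub>R u + b *\<^sub>R v) x = norm (a *\<^sub>R u + b *\<^sub>R v)"
      by (simp add: dist_norm)
    also have "\<dots> \<le> a * norm u + b * norm v"
      using that norm_triangle_ineq[of "a *\<^sub>R u" "b *\<^sub>R v"] by simp
    also have "\<dots> \<le> s * norm u + s * norm v"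
      using that by (intro add_mono mult_right_mono) auto
    also have "\<dots> < s * (norm u + norm v + 1)"
      using \<open>s > 0\<close> by (simp add: algebra_simps)
    also have "\<dots> = d"
      using pos by (simp add: s_def)
    finally show ?thesis .
  qed
  have "x + a *\<^sub>R u + b *\<^sub>R v \<in> S" if "0 \<le> a" "a \<le> s" "0 \<le> b" "b \<le> s" for a b
    using near[OF that] d3 by (auto simp: d_def dist_commute mem_ball)
  from second_difference_mean_value[OF assms(2) \<open>s > 0\<close> this]
  obtain a b where ab: "0 \<le> a" "a \<le> s" "0 \<le> b" "b \<le> s" and
    A: "f (x + s *\<^sub>R u + s *\<^sub>R v) - f (x + s *\<^sub>R u) - f (x + s *\<^sub>R v) + f x
      = s * s * A (x + a *\<^sub>R u + b *\<^sub>R v)"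
    unfolding A_def by blast
  \<comment> \<open>The same four values of \<open>f\<close> are now expanded with the roles of
    \<open>u\<close> and \<open>v\<close> exchanged.\<close>
  have "x + a *\<^sub>R v + b *\<^sub>R u \<in> S" if "0 \<le> a" "a \<le> s" "0 \<le> b" "b \<le> s" for a b
    using near[OF that(3,4,1,2)] d3 by (auto simp: d_def dist_commute mem_ball algebra_simps)
  from second_difference_mean_value[OF assms(2) \<open>s > 0\<close> this]
  obtain a' b' where ab': "0 \<le> a'" "a' \<le> s" "0 \<le> b'" "b' \<le> s" and
    B: "f (x + s *\<^sub>R v + s *\<^sub>R u) - f (x + s *\<^sub>R v) - f (x + s *\<^sub>R u) + f x
      = s * s * B (x + a' *\<^sub>R v + b' *\<^sub>R u)"
    unfolding B_def by blast
  have "s * s * A (x + a *\<^sub>R u + b *\<^sub>R v) = s * s * B (x + a' *\<^sub>R v + b' *\<^sub>R u)"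
    using A B by (simp add: algebra_simps)
  then have "A (x + a *\<^sub>R u + b *\<^sub>R v) = B (x + b' *\<^sub>R u + a' *\<^sub>R v)"
    using \<open>s > 0\<close> by (simp add: algebra_simps)
  moreover have "dist (A (x + a *\<^sub>R u + b *\<^sub>R v)) (A x) < \<epsilon>"
    using near[OF ab] by (intro d1) (simp add: d_def)
  moreover have "dist (B (x + b' *\<^sub>R u + a' *\<^sub>R v)) (B x) < \<epsilon>"
    using near[OF ab'(3,4,1,2)] by (intro d2) (simp add: d_def)
  ultimately show False
    unfolding \<epsilon>_def dist_real_def by (simp add: abs_if split: if_splits)
qed

lemma frechet_derivative_commute:
  fixes f :: "'a::real_normed_vector \<Rightarrow> 'b::euclidean_space"
  assumes "open S" "smooth_on S f" "x \<in> S"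
  shows "frechet_derivative (\<lambda>y. frechet_derivative f (at y) u) (at x) v
       = frechet_derivative (\<lambda>y. frechet_derivative f (at y) v) (at x) u"
proof (rule euclidean_eqI)
  fix b :: 'b
  define fb where "fb = (\<lambda>y. f y \<bullet> b)"
  have smooth_fb: "smooth_on S fb"
    unfolding fb_def
    by (rule smooth_on_bounded_linear_compose[OF assms(1) bounded_linear_inner_left assms(2)])
  have comp: "frechet_derivative (\<lambda>y. g y \<bullet> b) (at y) w = frechet_derivative g (at y) w \<bullet> b"
    if "smooth_on S g" "y \<in> S" for g :: "'a \<Rightarrow> 'b" and y w
    by (rule frechet_derivative_at[OF bounded_linear.has_derivative[OF bounded_linear_inner_left
          smooth_on_has_derivative[OF that]], THEN fun_cong, symmetric])
  have second: "frechet_derivative (\<lambda>y. frechet_derivative fb (at y) w) (at x) z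
      = frechet_derivative (\<lambda>y. frechet_derivative f (at y) w) (at x) z \<bullet> b" for w z
  proof -
    note D = smooth_on_frechet_derivative[OF assms(2), of w]
    have "frechet_derivative (\<lambda>y. frechet_derivative fb (at y) w) (at x)
        = frechet_derivative (\<lambda>y. frechet_derivative f (at y) w \<bullet> b) (at x)"
    proof (rule frechet_derivative_transform_within_open[OF _ assms(1,3)])
      show "(\<lambda>y. frechet_derivative fb (at y) w) differentiable at x"
        using smooth_on_has_derivative[OF smooth_on_frechet_derivative[OF smooth_fb] assms(3)]
        by (auto simp: differentiable_def)
      show "frechet_derivative fb (at y) w = frechet_derivative f (at y) w \<bullet> b" if "y \<in> S" for y
        unfolding fb_def by (rule comp[OF assms(2) that])
    qed
    then show ?thesis
      using comp[OF D assms(3), of z] by simp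
  qed
  show "frechet_derivative (\<lambda>y. frechet_derivative f (at y) u) (at x) v \<bullet> b
      = frechet_derivative (\<lambda>y. frechet_derivative f (at y) v) (at x) u \<bullet> b"
    using frechet_derivative_commute_real[OF assms(1) smooth_fb assms(3), of u v]
    by (simp add: second)
qed


text \<open>On a ball of small radius the mean value inequality improves the maximum of the sum of the
  norms by a factor of one half, so the maximum is zero.\<close>

lemma local_unique_continuation:
  fixes c :: "'i \<Rightarrow> 'a::euclidean_space \<Rightarrow> 'b::real_normed_vector"
  assumes "open M" "finite I" "p \<in> M" "0 < r"
    and der: "\<And>i x. i \<in> I \<Longrightarrow> x \<in> M \<Longrightarrow> (c i has_derivative c' i x) (at x)"
    and bound: "\<And>x i u. x \<in> ball p r \<inter> M \<Longrightarrow> i \<in> I \<Longrightarrow> u \<in> Basis \<Longrightarrow>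
      norm (c' i x u) \<le> K * (\<Sum>j\<in>I. norm (c j x))"
    and zero: "\<And>i. i \<in> I \<Longrightarrow> c i p = 0"
  shows "\<exists>R>0. \<forall>x\<in>ball p R. \<forall>i\<in>I. c i x = 0"
proof -
  define e where "e x = (\<Sum>j\<in>I. norm (c j x))" for x
  \<comment> \<open>\<open>real DIM('a) * \<bar>K\<bar>\<close> comes from bounding an operator norm
    by the sum over basis directions, and \<open>card I\<close> from summing the estimate over the
    family.\<close>
  define L where "L = real (card I) * (real DIM('a) * \<bar>K\<bar>)"
  obtain \<rho> where \<rho>: "\<rho> > 0" "cball p \<rho> \<subseteq> M"
    using assms(1,3) open_contains_cball by blast
  \<comment> \<open>The three bounds keep the closed ball inside \<open>M\<close>, keep it inside
    the open ball where \<open>bound\<close> applies, and force \<open>L * R\<close> to be at most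
    one half.\<close>
  define R where "R = min \<rho> (min (r / 2) (1 / (2 * (L + 1))))"
  have "L \<ge> 0"
    by (simp add: L_def)
  then have "R > 0"
    using \<rho>(1) assms(4) by (simp add: R_def)
  have LR: "L * R \<le> 1 / 2"
  proof -
    have "L * R \<le> L * (1 / (2 * (L + 1)))"
      using \<open>L \<ge> 0\<close> by (intro mult_left_mono) (auto simp: R_def)
    also have "\<dots> \<le> 1 / 2"
      using \<open>L \<ge> 0\<close> by (simp add: field_simps)
    finally show ?thesis .
  qed
  have sub: "cball p R \<subseteq> M" "cball p R \<subseteq> ball p r"
    using \<rho> assms(4) by (auto simp: R_def)
  have "continuous_on M (c i)" if "i \<in> I" for i
    using der[OF that] has_derivative_continuous continuous_at_imp_continuous_on by blast
  then have "continuous_on (cball p R) e"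
    unfolding e_def using sub(1)
    by (intro continuous_on_sum continuous_on_norm) (auto intro: continuous_on_subset)
  then obtain x where x: "x \<in> cball p R" and x_max: "\<And>y. y \<in> cball p R \<Longrightarrow> e y \<le> e x"
    using continuous_attains_sup[of "cball p R" e] \<open>R > 0\<close> by auto
  have e_nonneg: "e y \<ge> 0" for y
    by (simp add: e_def sum_nonneg)
  have "norm (c i x) \<le> real DIM('a) * \<bar>K\<bar> * e x * R" if i: "i \<in> I" for i
  proof -
    have "onorm (c' i y) \<le> real DIM('a) * \<bar>K\<bar> * e x" if y: "y \<in> cball p R" for y
    proof -
      have "norm (c' i y u) \<le> \<bar>K\<bar> * e x" if "u \<in> Basis" for u
      proof -
        have "norm (c' i y u) \<le> K * e y"
          unfolding e_def using y sub i that by (intro bound) auto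
        also have "\<dots> \<le> \<bar>K\<bar> * e x"
          using x_max[OF y] e_nonneg by (intro mult_mono) auto
        finally show ?thesis .
      qed
      then have "(\<Sum>u\<in>Basis. norm (c' i y u)) \<le> real DIM('a) * \<bar>K\<bar> * e x"
        using sum_bounded_above[of Basis "\<lambda>u. norm (c' i y u)" "\<bar>K\<bar> * e x"] by (simp add: mult.assoc)
      moreover have "bounded_linear (c' i y)"
        using der[OF i] y sub(1) has_derivative_bounded_linear by blast
      ultimately show ?thesis
        using onorm_componentwise order_trans by blast
    qed
    moreover have "(c i has_derivative c' i y) (at y within cball p R)" if "y \<in> cball p R" for y
      using der[OF i] sub(1) that has_derivative_at_withinI by blast
    ultimately have "norm (c i x - c i p) \<le> real DIM('a) * \<bar>K\<bar> * e x * norm (x - p)"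
      using x \<open>R > 0\<close> by (intro differentiable_bound[of "cball p R" "c i" "c' i"]) auto
    also have "\<dots> \<le> real DIM('a) * \<bar>K\<bar> * e x * R"
      using x e_nonneg by (intro mult_left_mono) (auto simp: dist_norm norm_minus_commute)
    finally show ?thesis
      using zero[OF i] by simp
  qed
  then have "e x \<le> real (card I) * (real DIM('a) * \<bar>K\<bar> * e x * R)"
    unfolding e_def[of x] using sum_bounded_above[of I "\<lambda>i. norm (c i x)"] by (simp add: e_def)
  also have "\<dots> = L * R * e x"
    by (simp add: L_def algebra_simps)
  also have "\<dots> \<le> 1 / 2 * e x"
    using LR e_nonneg by (intro mult_right_mono) auto
  finally have "e x = 0"
    using e_nonneg[of x] by simp
  have "c i y = 0" if "y \<in> ball p R" "i \<in> I" for y i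
  proof -
    have "e y = 0"
      using x_max[of y] \<open>e x = 0\<close> e_nonneg[of y] that(1) by auto
    then show ?thesis
      using that(2) assms(2) by (simp add: e_def sum_nonneg_eq_0_iff)
  qed
  with \<open>R > 0\<close> show ?thesis
    by blast
qed

text \<open>The common zero set of the family is closed by continuity and open by the local lemma.
  The bound is asked for near each point only, because the constants obtained later come from
  compactness of small balls.\<close>

lemma unique_continuation:
  fixes c :: "'i \<Rightarrow> 'a::euclidean_space \<Rightarrow> 'b::real_normed_vector"
  assumes "open M" "connected M" "finite I"
    and der: "\<And>i x. i \<in> I \<Longrightarrow> x \<in> M \<Longrightarrow> (c i has_derivative c' i x) (at x)"
    and bound: "\<And>p. p \<in> M \<Longrightarrow> \<exists>r>0. \<exists>K. \<forall>x \<in> ball p r \<inter> M. \<forall>i\<in>I. \<forall>u\<in>Basis.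
      norm (c' i x u) \<le> K * (\<Sum>j\<in>I. norm (c j x))"
    and "p \<in> M" "\<And>i. i \<in> I \<Longrightarrow> c i p = 0" "i \<in> I" "x \<in> M"
  shows "c i x = 0"
proof -
  define Z where "Z = {x \<in> M. \<forall>i\<in>I. c i x = 0}"
  have "open Z"
    unfolding open_contains_ball
  proof
    fix q assume "q \<in> Z"
    then have q: "q \<in> M" "\<And>i. i \<in> I \<Longrightarrow> c i q = 0"
      by (auto simp: Z_def)
    obtain r K where r: "r > 0" and "\<forall>x \<in> ball q r \<inter> M. \<forall>i\<in>I. \<forall>u\<in>Basis.
        norm (c' i x u) \<le> K * (\<Sum>j\<in>I. norm (c j x))"
      using bound[OF q(1)] by blast
    then have "\<exists>R>0. \<forall>x\<in>ball q R. \<forall>i\<in>I. c i x = 0"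
      by (intro local_unique_continuation[OF assms(1,3) q(1) r der _ q(2)]) blast+
    then obtain R where "R > 0" "\<forall>x\<in>ball q R. \<forall>i\<in>I. c i x = 0"
      by blast
    moreover obtain R' where "R' > 0" "ball q R' \<subseteq> M"
      using assms(1) q(1) open_contains_ball by blast
    ultimately show "\<exists>e>0. ball q e \<subseteq> Z"
      by (intro exI[of _ "min R R'"]) (auto simp: Z_def)
  qed
  then have "openin (top_of_set M) Z"
    by (auto simp: openin_open_eq[OF assms(1)] Z_def)
  moreover have "closedin (top_of_set M) Z"
  proof -
    define e where "e x = (\<Sum>j\<in>I. norm (c j x))" for x
    have "continuous_on M (c i)" if "i \<in> I" for i
      using der[OF that] has_derivative_continuous continuous_at_imp_continuous_on by blast
    then have "continuous_on M e"
      unfolding e_def by (intro continuous_on_sum continuous_on_norm)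
    moreover have "Z = {x \<in> M. e x = 0}"
      using assms(3) by (auto simp: Z_def e_def sum_nonneg_eq_0_iff)
    ultimately show ?thesis
      by (simp add: continuous_closedin_preimage_constant)
  qed
  moreover have "p \<in> Z"
    using assms(6,7) by (simp add: Z_def)
  ultimately have "Z = M"
    using assms(2) connected_clopen by blast
  with assms(8,9) show ?thesis
    by (auto simp: Z_def)
qed

section \<open>Matrix inversion and the trace metric\<close>

lemma bounded_bilinear_matrix_mult:
  "bounded_bilinear ((**) :: real^'n^'m \<Rightarrow> real^'p^'n \<Rightarrow> real^'p^'m)"
proof -
  have "bilinear ((**) :: real^'n^'m \<Rightarrow> real^'p^'n \<Rightarrow> real^'p^'m)"
    by (auto simp: bilinear_def linear_iff matrix_matrix_mult_def vec_eq_iff algebra_simps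
        sum.distrib sum_distrib_left)
  then show ?thesis
    by (simp add: bilinear_conv_bounded_bilinear)
qed

lemmas matrix_mult_algebra =
  bounded_bilinear.add_left[OF bounded_bilinear_matrix_mult]
  bounded_bilinear.add_right[OF bounded_bilinear_matrix_mult]
  bounded_bilinear.diff_left[OF bounded_bilinear_matrix_mult]
  bounded_bilinear.diff_right[OF bounded_bilinear_matrix_mult]
  bounded_bilinear.minus_left[OF bounded_bilinear_matrix_mult]
  bounded_bilinear.minus_right[OF bounded_bilinear_matrix_mult]
  bounded_bilinear.scaleR_left[OF bounded_bilinear_matrix_mult]
  bounded_bilinear.scaleR_right[OF bounded_bilinear_matrix_mult]

lemma bounded_linear_trace: "bounded_linear (trace :: real^'n^'n \<Rightarrow> real)"
  by (simp add: linear_conv_bounded_linear[symmetric] linear_iff trace_def sum.distrib sum_distrib_left)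

lemma bounded_linear_transpose: "bounded_linear (transpose :: real^'n^'m \<Rightarrow> real^'m^'n)"
  by (simp add: linear_conv_bounded_linear[symmetric] linear_iff transpose_def vec_eq_iff)

lemma matrix_inv_right: "invertible A \<Longrightarrow> A ** matrix_inv A = mat 1"
  and matrix_inv_left: "invertible A \<Longrightarrow> matrix_inv A ** A = mat 1"
  unfolding invertible_def matrix_inv_def by (rule someI2_ex; simp)+

lemma matrix_inv_cancel:
  fixes A :: "real^'n^'n" and B :: "real^'m^'n" and C :: "real^'n^'m"
  assumes "A \<in> GL"
  shows "A ** (matrix_inv A ** B) = B" "matrix_inv A ** (A ** B) = B"
    "C ** A ** matrix_inv A = C" "C ** matrix_inv A ** A = C"
    "A ** matrix_inv A = mat 1" "matrix_inv A ** A = mat 1"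
  using assms matrix_inv_right[of A] matrix_inv_left[of A]
  by (simp_all add: GL_def matrix_mul_assoc) (simp_all flip: matrix_mul_assoc)

lemma matrix_inv_eqI:
  fixes A B :: "real^'n^'n"
  assumes "A ** B = mat 1"
  shows "matrix_inv A = B"
proof -
  have "A \<in> GL"
    using assms by (auto simp: GL_def invertible_right_inverse)
  then show ?thesis
    by (metis assms matrix_inv_cancel(2) matrix_mul_rid)
qed

lemma matrix_inv_in_GL: "A \<in> GL \<Longrightarrow> matrix_inv A \<in> GL"
  using matrix_inv_cancel(6) by (auto simp: GL_def invertible_right_inverse)

lemma matrix_mult_in_GL: "A \<in> GL \<Longrightarrow> B \<in> GL \<Longrightarrow> A ** B \<in> GL"
  by (simp add: GL_def invertible_mult)

lemma transpose_in_GL: "A \<in> GL \<Longrightarrow> transpose A \<in> GL"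
  by (simp add: GL_def transpose_invertible)

lemma mat_1_in_GL: "mat 1 \<in> GL"
  by (auto simp: GL_def invertible_def)

lemma matrix_inv_matrix_inv: "A \<in> GL \<Longrightarrow> matrix_inv (matrix_inv A) = A"
  by (simp add: matrix_inv_eqI matrix_inv_cancel)

lemma matrix_inv_mat_1: "matrix_inv (mat 1) = (mat 1 :: real^'n^'n)"
  by (simp add: matrix_inv_eqI)

lemma matrix_inv_mult:
  assumes "A \<in> GL" "B \<in> GL"
  shows "matrix_inv (A ** B) = matrix_inv B ** matrix_inv A"
proof (rule matrix_inv_eqI)
  have "A ** B ** (matrix_inv B ** matrix_inv A) = A ** (B ** (matrix_inv B ** matrix_inv A))"
    by (simp add: matrix_mul_assoc)
  then show "A ** B ** (matrix_inv B ** matrix_inv A) = mat 1"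
    using assms by (simp add: matrix_inv_cancel)
qed

lemma matrix_inv_transpose: "A \<in> GL \<Longrightarrow> matrix_inv (transpose A) = transpose (matrix_inv A)"
  by (rule matrix_inv_eqI) (simp add: matrix_transpose_mul[symmetric] matrix_inv_cancel transpose_mat)

lemma GL_eq_det: "GL = {A. det A \<noteq> 0}"
  by (simp add: GL_def invertible_det_nz)

lemma continuous_on_det:
  fixes A :: "'a::topological_space \<Rightarrow> real^'n^'n"
  assumes "continuous_on S A"
  shows "continuous_on S (\<lambda>x. det (A x))"
  unfolding det_def by (intro continuous_intros assms)

lemma open_GL: "open (GL :: (real^'n^'n) set)"
  unfolding GL_eq_det by (intro open_Collect_neq continuous_on_det continuous_intros)

lemma GL_pos_eq_det: "GL_pos = {A. 0 < det A}"
  by (auto simp: GL_pos_def GL_eq_det)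

lemma GL_neg_eq_det: "GL_neg = {A. det A < 0}"
  by (auto simp: GL_neg_def GL_eq_det)

lemma open_GL_pos: "open (GL_pos :: (real^'n^'n) set)"
  unfolding GL_pos_eq_det by (intro open_Collect_less continuous_on_det continuous_intros)

lemma open_GL_neg: "open (GL_neg :: (real^'n^'n) set)"
  unfolding GL_neg_eq_det by (intro open_Collect_less continuous_on_det continuous_intros)

section \<open>Continuity and smoothness of matrix inversion\<close>

text \<open>Cramer's rule, since column \<open>l\<close> of the inverse solves the linear system
  with the \<open>l\<close>-th unit vector on the right. It shows continuity of inversion, which the
  proof of differentiability presupposes.\<close>

lemma matrix_inv_component:
  assumes "A \<in> GL"
  shows "matrix_inv A $ k $ l = det (\<chi> i j. if j = k then mat 1 $ i $ l else A $ i $ j) / det A"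
proof -
  have "A *v column l (matrix_inv A) = column l (mat 1)"
    using matrix_inv_cancel(5)[OF assms]
    by (auto simp: vec_eq_iff column_def matrix_vector_mult_def matrix_matrix_mult_def)
  then have "column l (matrix_inv A)
      = (\<chi> k. det (\<chi> i j. if j = k then column l (mat 1) $ i else A $ i $ j) / det A)"
    using assms by (subst (asm) cramer) (auto simp: GL_eq_det)
  then show ?thesis
    by (simp add: vec_eq_iff column_def cong: if_cong)
qed

lemma continuous_on_matrix_inv: "continuous_on GL (matrix_inv :: real^'n^'n \<Rightarrow> real^'n^'n)"
proof -
  have "continuous_on GL (\<lambda>A :: real^'n^'n. (\<chi> k l. det (\<chi> i j. if j = k then mat 1 $ i $ l else A $ i $ j) / det A))"
  proof (intro continuous_on_vec_lambda continuous_on_divide continuous_on_det)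
    show "continuous_on GL (\<lambda>A :: real^'n^'n. if j = k then mat 1 $ i $ l else A $ i $ j)" for i j k l
      by (cases "j = k") (auto intro!: continuous_intros)
  qed (auto simp: GL_eq_det intro: continuous_intros)
  moreover have "matrix_inv A = (\<chi> k l. det (\<chi> i j. if j = k then mat 1 $ i $ l else A $ i $ j) / det A)"
    if "A \<in> GL" for A :: "real^'n^'n"
    by (simp add: vec_eq_iff matrix_inv_component[OF that])
  ultimately show ?thesis
    by (metis (no_types, lifting) continuous_on_cong)
qed

text \<open>The remainder factors exactly as - (X^-1 - A^-1) (X - A) A^-1. Divided by the norm of X
  - A it is bounded by a multiple of the norm of X^-1 - A^-1, which tends to 0 by
  continuity.\<close>

lemma has_derivative_matrix_inv:
  fixes A :: "real^'n^'n"
  assumes "A \<in> GL"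
  shows "(matrix_inv has_derivative (\<lambda>V. - (matrix_inv A ** V ** matrix_inv A))) (at A)"
  unfolding has_derivative_iff_norm
proof
  show "bounded_linear (\<lambda>V. - (matrix_inv A ** V ** matrix_inv A))"
    by (intro bounded_linear_minus
        bounded_linear_compose[OF bounded_bilinear.bounded_linear_left[OF bounded_bilinear_matrix_mult]]
        bounded_bilinear.bounded_linear_right[OF bounded_bilinear_matrix_mult])
  obtain K where "K \<ge> 0" and K: "\<And>(B :: real^'n^'n) (C :: real^'n^'n). norm (B ** C) \<le> norm B * norm C * K"
    using bounded_bilinear.nonneg_bounded[OF bounded_bilinear_matrix_mult] by blast
  define b where "b X = norm (matrix_inv X - matrix_inv A) * K * norm (matrix_inv A) * K" for X
  have cont: "isCont matrix_inv A"
    using continuous_on_matrix_inv open_GL assms continuous_on_eq_continuous_at by blast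
  have "norm (matrix_inv X - matrix_inv A - - (matrix_inv A ** (X - A) ** matrix_inv A)) / norm (X - A)
      \<le> b X" if "X \<in> GL" "X \<noteq> A" for X
  proof -
    have "matrix_inv X - matrix_inv A - - (matrix_inv A ** (X - A) ** matrix_inv A)
        = - ((matrix_inv X - matrix_inv A) ** (X - A) ** matrix_inv A)"
      by (simp only: matrix_mult_algebra matrix_inv_cancel[OF assms] matrix_inv_cancel[OF that(1)]
          matrix_mul_lid) simp
    then have "norm (matrix_inv X - matrix_inv A - - (matrix_inv A ** (X - A) ** matrix_inv A))
        = norm ((matrix_inv X - matrix_inv A) ** (X - A) ** matrix_inv A)"
      by simp
    also have "\<dots> \<le> norm ((matrix_inv X - matrix_inv A) ** (X - A)) * norm (matrix_inv A) * K"
      by (rule K)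
    also have "\<dots> \<le> norm (matrix_inv X - matrix_inv A) * norm (X - A) * K * norm (matrix_inv A) * K"
      using K \<open>K \<ge> 0\<close> by (intro mult_right_mono) auto
    finally show ?thesis
      using that(2) by (simp add: field_simps b_def)
  qed
  then have "\<forall>\<^sub>F X in at A. norm (norm (matrix_inv X - matrix_inv A
      - - (matrix_inv A ** (X - A) ** matrix_inv A)) / norm (X - A)) \<le> b X"
    unfolding eventually_at_topological using open_GL assms
    by (intro exI[of _ GL]) auto
  moreover have "(b \<longlongrightarrow> 0) (at A)"
  proof -
    have "(b \<longlongrightarrow> norm (matrix_inv A - matrix_inv A) * K * norm (matrix_inv A) * K) (at A)"
      unfolding b_def using cont by (intro tendsto_intros) (simp add: isCont_def)
    then show ?thesis
      by simp
  qed
  ultimately show "((\<lambda>X. norm (matrix_inv X - matrix_inv A - - (matrix_inv A ** (X - A) ** matrix_inv A))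
      / norm (X - A)) \<longlongrightarrow> 0) (at A)"
    by (rule Lim_null_comparison)
qed

text \<open>Bootstrapping: the derivative is a polynomial expression in the inverse itself, so each
  order of differentiability yields the next.\<close>

lemma smooth_on_matrix_inv: "smooth_on GL (matrix_inv :: real^'n^'n \<Rightarrow> real^'n^'n)"
proof -
  have "Ck_on k GL (matrix_inv :: real^'n^'n \<Rightarrow> real^'n^'n)" for k
  proof (induction k)
    case 0
    then show ?case
      by (simp add: continuous_on_matrix_inv)
  next
    case (Suc k)
    show ?case
    proof (rule Ck_on_SucI[OF open_GL has_derivative_matrix_inv])
      show "Ck_on k GL (\<lambda>A. - (matrix_inv A ** V ** matrix_inv A))" for V :: "real^'n^'n"
        by (intro Ck_on_bounded_linear_compose[OF open_GL bounded_linear_minus[OF bounded_linear_ident]]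
            Ck_on_bilinear[OF open_GL bounded_bilinear_matrix_mult] Suc Ck_on_const)
    qed
  qed
  then show ?thesis
    by (simp add: smooth_on_def)
qed

section \<open>The trace form as a semi-Riemannian metric\<close>

lemma trace_metric_alt: "trace_metric A V W = trace ((matrix_inv A ** V) ** (matrix_inv A ** W))"
  by (simp add: trace_metric_def matrix_mul_assoc)

lemma trace_metric_sym: "trace_metric A V W = trace_metric A W V"
  unfolding trace_metric_alt by (rule trace_mul_sym)

lemma bilinear_trace_metric: "bilinear (trace_metric A)"
  unfolding bilinear_def trace_metric_def
  by (auto simp: linear_iff matrix_mult_algebra linear_add[OF bounded_linear.linear[OF bounded_linear_trace]]
      linear_cmul[OF bounded_linear.linear[OF bounded_linear_trace]])

lemma trace_mult_transpose: "trace (A ** transpose A) = (norm (A :: real^'n^'m))\<^sup>2"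
  by (simp add: trace_def matrix_matrix_mult_def transpose_def power2_norm_eq_inner inner_vec_def)

text \<open>Testing \<open>V\<close> against the transpose of A^-1 V A^-1 produces the squared
  Euclidean norm of that matrix.\<close>

lemma nondegenerate_trace_metric:
  assumes "A \<in> GL"
  shows "nondegenerate_form (trace_metric A)"
  unfolding nondegenerate_form_def
proof (intro allI impI)
  fix V assume "\<forall>W. trace_metric A V W = 0"
  then have "trace ((matrix_inv A ** V ** matrix_inv A) ** transpose (matrix_inv A ** V ** matrix_inv A)) = 0"
    unfolding trace_metric_def by blast
  then have "matrix_inv A ** V ** matrix_inv A = 0"
    by (simp add: trace_mult_transpose)
  then have "A ** (matrix_inv A ** V ** matrix_inv A) ** A = 0"
    by (simp add: bounded_bilinear.zero_left[OF bounded_bilinear_matrix_mult]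
        bounded_bilinear.zero_right[OF bounded_bilinear_matrix_mult])
  then show "V = 0"
    using assms by (simp add: matrix_mul_assoc matrix_inv_cancel)
qed

lemma smooth_on_trace_metric: "smooth_on GL (\<lambda>A. trace_metric A V W)"
  unfolding trace_metric_def
  by (intro smooth_on_bounded_linear_compose[OF open_GL bounded_linear_trace]
      smooth_on_bilinear[OF open_GL bounded_bilinear_matrix_mult] smooth_on_matrix_inv)
    (auto simp: smooth_on_def Ck_on_const)

text \<open>A linear bijection matches the negative definite subspaces of the two forms and
  preserves dimension, so both maxima range over the same set of numbers.\<close>

lemma form_index_pullback:
  fixes L :: "'a::euclidean_space \<Rightarrow> 'a"
  assumes "linear L" "bij L"
  shows "form_index (\<lambda>v w. b (L v) (L w)) = form_index b"
proof -
  have "(\<exists>W. d = dim W \<and> subspace W \<and> (\<forall>v\<in>W. v \<noteq> 0 \<longrightarrow> b (L v) (L v) < 0))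
      \<longleftrightarrow> (\<exists>W. d = dim W \<and> subspace W \<and> (\<forall>v\<in>W. v \<noteq> 0 \<longrightarrow> b v v < 0))" (is "?P \<longleftrightarrow> ?Q") for d
  proof
    have L0: "L v = 0 \<longleftrightarrow> v = 0" for v
      using assms linear_0 bij_is_inj[OF assms(2)] by (metis injD)
    show ?Q if ?P
    proof -
      from that obtain W where W: "d = dim W" "subspace W" "\<forall>v\<in>W. v \<noteq> 0 \<longrightarrow> b (L v) (L v) < 0"
        by blast
      have "dim (L ` W) = dim W"
        using assms bij_is_inj inj_on_subset by (intro dim_image_eq) (auto, blast)
      with W L0 show ?Q
        by (intro exI[of _ "L ` W"]) (auto simp: linear_subspace_image[OF assms(1)])
    qed
    show ?P if ?Q
    proof -
      from that obtain W where W: "d = dim W" "subspace W" "\<forall>v\<in>W. v \<noteq> 0 \<longrightarrow> b v v < 0"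
        by blast
      have "dim (L ` (L -` W)) = dim (L -` W)"
        using assms bij_is_inj inj_on_subset by (intro dim_image_eq) (auto, blast)
      moreover have "L ` (L -` W) = W"
        using bij_is_surj[OF assms(2)] by (simp add: surj_image_vimage_eq)
      ultimately show ?P
        using W L0 linear_subspace_vimage[OF assms(1) W(2)] by (intro exI[of _ "L -` W"]) auto
    qed
  qed
  then show ?thesis
    unfolding form_index_def by presburger
qed

text \<open>The index is constant because the form at \<open>A\<close> is the form at the identity
  pulled back by left multiplication with A^-1; its value never has to be computed.\<close>

lemma semi_riemannian_manifold_trace_metric:
  fixes M :: "(real^'n^'n) set"
  assumes "open M" "M \<subseteq> GL"
  shows "semi_riemannian_manifold M trace_metric"
proof -
  have "form_index (trace_metric A) = form_index (trace_metric (mat 1 :: real^'n^'n))"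
    if "A \<in> GL" for A :: "real^'n^'n"
  proof -
    have "bij ((**) (matrix_inv A) :: real^'n^'n \<Rightarrow> real^'n^'n)"
      by (rule bij_betw_byWitness[of _ "(**) A"]) (auto simp: matrix_inv_cancel that)
    moreover have "linear ((**) (matrix_inv A) :: real^'n^'n \<Rightarrow> real^'n^'n)"
      by (simp add: linear_iff matrix_mult_algebra)
    moreover have "trace_metric A = (\<lambda>V W. trace_metric (mat 1) (matrix_inv A ** V) (matrix_inv A ** W))"
      by (simp add: fun_eq_iff trace_metric_alt matrix_inv_mat_1)
    ultimately show ?thesis
      by (simp add: form_index_pullback)
  qed
  moreover have "smooth_on M (\<lambda>A. trace_metric A V W)" for V W
    using smooth_on_mono[OF assms(2) smooth_on_trace_metric] .
  ultimately show ?thesis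
    using assms unfolding semi_riemannian_manifold_def symmetric_form_def
    by (auto simp: bilinear_trace_metric nondegenerate_trace_metric subset_iff trace_metric_sym)
qed

section \<open>Isometries of the trace metric\<close>

lemma diffeomorphism_onI:
  assumes "open N" "smooth_on M f" "smooth_on N h"
    and "\<And>x. x \<in> M \<Longrightarrow> f x \<in> N" "\<And>y. y \<in> N \<Longrightarrow> h y \<in> M"
    and hf: "\<And>x. x \<in> M \<Longrightarrow> h (f x) = x" and fh: "\<And>y. y \<in> N \<Longrightarrow> f (h y) = y"
  shows "diffeomorphism_on M N f"
  unfolding diffeomorphism_on_def
proof (intro conjI)
  show bij: "bij_betw f M N"
    by (rule bij_betw_byWitness[of _ h]) (use assms in auto)
  have "h y = inv_into M f y" if "y \<in> N" for y
    using that assms(5) bij by (metis bij_betw_inv_into_left fh)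
  then show "smooth_on N (inv_into M f)"
    using smooth_on_eq[OF assms(1) _ assms(3)] by blast
qed fact

lemma isometry_ofI:
  fixes f :: "'a::euclidean_space \<Rightarrow> 'a"
  assumes "open M" "smooth_on M f" "smooth_on M h"
    and "\<And>x. x \<in> M \<Longrightarrow> f x \<in> M" "\<And>x. x \<in> M \<Longrightarrow> h x \<in> M"
    and "\<And>x. x \<in> M \<Longrightarrow> h (f x) = x" "\<And>x. x \<in> M \<Longrightarrow> f (h x) = x"
    and der: "\<And>p. p \<in> M \<Longrightarrow> (f has_derivative f' p) (at p)"
    and metric: "\<And>p v w. p \<in> M \<Longrightarrow> g (f p) (f' p v) (f' p w) = g p v w"
  shows "isometry_of M g f"
  unfolding isometry_of_def
  using diffeomorphism_onI[OF assms(1-7)] frechet_derivative_at[OF der, symmetric] metric by auto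

lemma isometry_of_comp:
  fixes f h :: "'a::euclidean_space \<Rightarrow> 'a"
  assumes "open M" "isometry_of M g f" "isometry_of M g h"
  shows "isometry_of M g (f \<circ> h)"
proof (rule isometry_ofI[OF assms(1)])
  have f: "bij_betw f M M" "smooth_on M f" "smooth_on M (inv_into M f)"
    and h: "bij_betw h M M" "smooth_on M h" "smooth_on M (inv_into M h)"
    using assms(2,3) by (auto simp: isometry_of_def diffeomorphism_on_def)
  show "smooth_on M (f \<circ> h)"
    using f h by (intro smooth_on_compose[OF assms(1), of _ M]) (auto simp: bij_betw_def)
  show "smooth_on M (inv_into M h \<circ> inv_into M f)"
    using f h by (intro smooth_on_compose[OF assms(1), of _ M]) (auto simp: bij_betw_def inv_into_into)
  show "(f \<circ> h) x \<in> M" "(inv_into M h \<circ> inv_into M f) x \<in> M"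
    "(inv_into M h \<circ> inv_into M f) ((f \<circ> h) x) = x"
    "(f \<circ> h) ((inv_into M h \<circ> inv_into M f) x) = x" if "x \<in> M" for x
    using that f(1) h(1)
    by (auto simp: bij_betw_apply bij_betw_inv_into_left bij_betw_inv_into_right
        bij_betw_apply[OF bij_betw_inv_into])
  show "((f \<circ> h) has_derivative (frechet_derivative f (at (h p)) \<circ> frechet_derivative h (at p))) (at p)"
    if "p \<in> M" for p
    using that f h by (intro diff_chain_at smooth_on_has_derivative) (auto simp: bij_betw_apply)
  show "g ((f \<circ> h) p) ((frechet_derivative f (at (h p)) \<circ> frechet_derivative h (at p)) v)
      ((frechet_derivative f (at (h p)) \<circ> frechet_derivative h (at p)) w) = g p v w"
    if "p \<in> M" for p v w
    using that assms(2,3) h(1) by (auto simp: isometry_of_def bij_betw_apply)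
qed

text \<open>This carries isometries of the whole group over to an open piece that they preserve. The
  inverse is taken as \<open>inv_into N f\<close>, whose smoothness is already known.\<close>

lemma isometry_of_subset:
  fixes f :: "'a::euclidean_space \<Rightarrow> 'a"
  assumes "isometry_of N g f" "M \<subseteq> N" "open M" "f ` M = M"
  shows "isometry_of M g f"
proof -
  have f: "bij_betw f N N" "smooth_on N f" "smooth_on N (inv_into N f)"
    using assms(1) by (auto simp: isometry_of_def diffeomorphism_on_def)
  have inv: "inv_into N f (f x) = x" if "x \<in> M" for x
    using that assms(2) f(1) by (auto simp: bij_betw_inv_into_left)
  show ?thesis
  proof (rule isometry_ofI[OF assms(3)])
    show "smooth_on M f" "smooth_on M (inv_into N f)"
      using smooth_on_mono[OF assms(2)] f by auto
    show "f x \<in> M" if "x \<in> M" for x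
      using that assms(4) by blast
    show "inv_into N f x \<in> M" if "x \<in> M" for x
      using that assms(4) inv by (metis imageE)
    show "f (inv_into N f x) = x" if "x \<in> M" for x
      using that assms(2) f(1) by (auto simp: bij_betw_inv_into_right)
    show "(f has_derivative frechet_derivative f (at p)) (at p)" if "p \<in> M" for p
      using that assms(2) f(2) by (auto intro: smooth_on_has_derivative)
    show "g (f p) (frechet_derivative f (at p) v) (frechet_derivative f (at p) w) = g p v w"
      if "p \<in> M" for p v w
      using that assms(1,2) by (auto simp: isometry_of_def)
  qed (use inv in auto)
qed

section \<open>The individual isometries of the general linear group\<close>

lemma bounded_linear_left_translation: "bounded_linear (left_translation G)"
  unfolding left_translation_def
  by (rule bounded_bilinear.bounded_linear_right[OF bounded_bilinear_matrix_mult])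

lemma bounded_linear_right_translation: "bounded_linear (right_translation G)"
  unfolding right_translation_def
  by (rule bounded_bilinear.bounded_linear_left[OF bounded_bilinear_matrix_mult])

lemma isometry_left_translation:
  fixes G :: "real^'n^'n"
  assumes "G \<in> GL"
  shows "isometry_of GL trace_metric (left_translation G)"
proof (rule isometry_ofI[OF open_GL])
  show "smooth_on GL (left_translation G)" "smooth_on GL (left_translation (matrix_inv G))"
    by (intro smooth_on_bounded_linear bounded_linear_left_translation)+
  show "(left_translation G has_derivative left_translation G) (at p)" for p
    by (rule bounded_linear_imp_has_derivative[OF bounded_linear_left_translation])
  show "trace_metric (left_translation G p) (left_translation G v) (left_translation G w)
      = trace_metric p v w" if "p \<in> GL" for p v w
  proof -
    have "matrix_inv p ** matrix_inv G ** (G ** x) = matrix_inv p ** x" for x :: "real^'n^'n"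
      using assms by (simp add: matrix_inv_cancel flip: matrix_mul_assoc)
    then show ?thesis
      using assms that by (simp add: left_translation_def trace_metric_alt matrix_inv_mult)
  qed
qed (auto simp: left_translation_def assms matrix_mult_in_GL matrix_inv_in_GL matrix_inv_cancel)

lemma isometry_right_translation:
  assumes "G \<in> GL"
  shows "isometry_of GL trace_metric (right_translation G)"
proof (rule isometry_ofI[OF open_GL])
  show "smooth_on GL (right_translation G)" "smooth_on GL (right_translation (matrix_inv G))"
    by (intro smooth_on_bounded_linear bounded_linear_right_translation)+
  show "(right_translation G has_derivative right_translation G) (at p)" for p
    by (rule bounded_linear_imp_has_derivative[OF bounded_linear_right_translation])
  show "trace_metric (right_translation G p) (right_translation G v) (right_translation G w)
      = trace_metric p v w" if "p \<in> GL" for p v w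
  proof -
    \<comment> \<open>The right translation only conjugates the matrix under the trace by
      \<open>G\<close>.\<close>
    have "trace_metric (right_translation G p) (right_translation G v) (right_translation G w)
        = trace (matrix_inv G ** (matrix_inv p ** v ** matrix_inv p ** w ** G))"
      using assms that
      by (simp add: right_translation_def trace_metric_def matrix_inv_mult matrix_mul_assoc matrix_inv_cancel)
    also have "\<dots> = trace_metric p v w"
      using assms by (subst trace_mul_sym) (simp add: trace_metric_def matrix_inv_cancel)
    finally show ?thesis .
  qed
qed (auto simp: right_translation_def assms matrix_mult_in_GL matrix_inv_in_GL matrix_inv_cancel)

text \<open>The two minus signs cancel, and what remains is the trace of v p^-1 w p^-1, a cyclic
  rotation of the original product.\<close>

lemma isometry_matrix_inv: "isometry_of GL trace_metric (matrix_inv :: real^'n^'n \<Rightarrow> real^'n^'n)"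
proof (rule isometry_ofI[OF open_GL smooth_on_matrix_inv smooth_on_matrix_inv _ _ _ _ has_derivative_matrix_inv])
  show "trace_metric (matrix_inv p) (- (matrix_inv p ** v ** matrix_inv p))
      (- (matrix_inv p ** w ** matrix_inv p)) = trace_metric p v w" if "p \<in> GL" for p v w :: "real^'n^'n"
  proof -
    have "p ** (matrix_inv p ** x ** matrix_inv p) = x ** matrix_inv p" for x
      using that by (simp add: matrix_mul_assoc matrix_inv_cancel)
    then have "trace_metric (matrix_inv p) (- (matrix_inv p ** v ** matrix_inv p))
        (- (matrix_inv p ** w ** matrix_inv p)) = trace ((v ** matrix_inv p ** w) ** matrix_inv p)"
      using that by (simp add: trace_metric_alt matrix_inv_matrix_inv matrix_mult_algebra matrix_mul_assoc)
    then show ?thesis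
      by (subst (asm) trace_mul_sym) (simp add: trace_metric_def matrix_mul_assoc)
  qed
qed (auto simp: matrix_inv_in_GL matrix_inv_matrix_inv)

lemma isometry_transpose: "isometry_of GL trace_metric (transpose :: real^'n^'n \<Rightarrow> real^'n^'n)"
proof (rule isometry_ofI[OF open_GL, where h = transpose])
  show "trace_metric (transpose p) (transpose v) (transpose w) = trace_metric p v w"
    if "p \<in> GL" for p v w :: "real^'n^'n"
  proof -
    have trace_transpose: "trace (transpose A) = trace A" for A :: "real^'n^'n"
      by (simp add: trace_def transpose_def)
    have "trace_metric (transpose p) (transpose v) (transpose w)
        = trace (transpose (w ** (matrix_inv p ** v ** matrix_inv p)))"
      using that
      by (simp add: trace_metric_def matrix_inv_transpose matrix_transpose_mul matrix_mul_assoc)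
    also have "\<dots> = trace (matrix_inv p ** v ** matrix_inv p ** w)"
      by (simp only: trace_transpose) (rule trace_mul_sym)
    finally show ?thesis
      by (simp add: trace_metric_def)
  qed
  show "(transpose has_derivative transpose) (at p)" for p :: "real^'n^'n"
    by (rule bounded_linear_imp_has_derivative[OF bounded_linear_transpose])
qed (auto simp: transpose_in_GL intro: smooth_on_bounded_linear bounded_linear_transpose)

lemma isometry_basic_maps:
  fixes f :: "real^'n^'n \<Rightarrow> real^'n^'n"
  assumes "f \<in> basic_maps"
  shows "isometry_of GL trace_metric f"
proof -
  have "conjugacy G = left_translation (matrix_inv G) \<circ> right_translation G" for G :: "real^'n^'n"
    by (simp add: fun_eq_iff conjugacy_def left_translation_def right_translation_def matrix_mul_assoc)
  then have "isometry_of GL trace_metric (conjugacy G)" if "G \<in> GL" for G :: "real^'n^'n"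
    using that by (simp add: isometry_of_comp[OF open_GL] isometry_left_translation
        isometry_right_translation matrix_inv_in_GL)
  moreover have "congruence G = left_translation (transpose G) \<circ> right_translation G" for G :: "real^'n^'n"
    by (simp add: fun_eq_iff congruence_def left_translation_def right_translation_def matrix_mul_assoc)
  then have "isometry_of GL trace_metric (congruence G)" if "G \<in> GL" for G :: "real^'n^'n"
    using that by (simp add: isometry_of_comp[OF open_GL] isometry_left_translation
        isometry_right_translation transpose_in_GL)
  moreover have "uminus = left_translation (- mat 1 :: real^'n^'n)"
    by (simp add: fun_eq_iff left_translation_def matrix_mult_algebra)
  moreover have "- mat 1 \<in> (GL :: (real^'n^'n) set)"
    by (auto simp: GL_def invertible_right_inverse matrix_mult_algebra intro!: exI[of _ "- mat 1"])
  ultimately show ?thesis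
    using assms isometry_left_translation[of "- mat 1 :: real^'n^'n"] unfolding basic_maps_def
    by (auto simp: isometry_left_translation isometry_right_translation
        isometry_matrix_inv isometry_transpose)
qed

section \<open>The candidate symmetries\<close>

lemma psi_apply: "psi A X = A ** matrix_inv X ** A"
  by (simp add: psi_def left_translation_def right_translation_def)

lemma isometry_psi:
  assumes "A \<in> GL"
  shows "isometry_of GL trace_metric (psi A)"
  unfolding psi_def
  by (intro isometry_of_comp[OF open_GL] isometry_left_translation isometry_right_translation
      isometry_matrix_inv assms)

lemma has_derivative_psi:
  assumes "A \<in> GL"
  shows "(psi A has_derivative uminus) (at A)"
proof -
  have "(psi A has_derivative (right_translation A \<circ> left_translation A \<circ>
      (\<lambda>V. - (matrix_inv A ** V ** matrix_inv A)))) (at A)"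
    unfolding psi_def
    by (intro diff_chain_at has_derivative_matrix_inv assms bounded_linear_imp_has_derivative
        bounded_linear_left_translation bounded_linear_right_translation)
  moreover have "right_translation A \<circ> left_translation A \<circ> (\<lambda>V. - (matrix_inv A ** V ** matrix_inv A)) = uminus"
    using assms by (simp add: fun_eq_iff left_translation_def right_translation_def matrix_mult_algebra
        matrix_mul_assoc matrix_inv_cancel)
  ultimately show ?thesis
    by simp
qed

lemma psi_psi:
  assumes "A \<in> GL" "X \<in> GL"
  shows "psi A (psi A X) = X"
  using assms
  by (simp add: psi_apply matrix_inv_mult matrix_inv_in_GL matrix_mult_in_GL matrix_inv_matrix_inv
      matrix_mul_assoc matrix_inv_cancel)

lemma symmetry_at_psi:
  assumes "A \<in> M" "M \<subseteq> GL" "open M" "\<And>X. X \<in> M \<Longrightarrow> psi A X \<in> M"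
  shows "symmetry_at M trace_metric A (psi A)"
proof -
  have A: "A \<in> GL"
    using assms by blast
  \<comment> \<open>Since \<open>psi A\<close> is an involution, mapping \<open>M\<close> into
    itself already makes it onto.\<close>
  have "psi A ` M = M"
    using assms psi_psi[OF A] by (auto simp: image_iff) (metis subsetD)
  then have "isometry_of M trace_metric (psi A)"
    using isometry_of_subset[OF isometry_psi[OF A]] assms by blast
  moreover have "psi A A = A"
    using A by (simp add: psi_apply matrix_inv_cancel)
  ultimately show ?thesis
    using frechet_derivative_at[OF has_derivative_psi[OF A], symmetric]
    by (simp add: symmetry_at_def)
qed

lemma det_matrix_inv:
  assumes "A \<in> GL"
  shows "det (matrix_inv A) = inverse (det A)"
  using det_mul[of A "matrix_inv A"] matrix_inv_cancel(5)[OF assms] assms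
  by (simp add: GL_eq_det field_simps)

text \<open>The determinant of \<open>psi A X\<close> is (det A)^2 / det X, which has the sign of
  det X; the negative component is preserved for the same reason.\<close>

lemma symmetry_at_psi_GL_pos:
  assumes "A \<in> GL_pos"
  shows "symmetry_at GL_pos trace_metric A (psi A)"
proof (rule symmetry_at_psi[OF assms _ open_GL_pos])
  show "psi A X \<in> GL_pos" if "X \<in> GL_pos" for X
    using assms that by (simp add: GL_pos_def psi_apply matrix_mult_in_GL matrix_inv_in_GL det_mul det_matrix_inv)
qed (auto simp: GL_pos_def)

lemma symmetry_at_psi_GL_neg:
  assumes "A \<in> GL_neg"
  shows "symmetry_at GL_neg trace_metric A (psi A)"
proof (rule symmetry_at_psi[OF assms _ open_GL_neg])
  show "psi A X \<in> GL_neg" if "X \<in> GL_neg" for X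
    using assms that
    by (simp add: GL_neg_def psi_apply matrix_mult_in_GL matrix_inv_in_GL det_mul det_matrix_inv
        mult_neg_neg mult_pos_neg)
qed (auto simp: GL_neg_def)

section \<open>Rigidity of isometries\<close>

text \<open>Minus the derivative of the metric: moving the base point in direction \<open>U\<close>
  changes the value on fixed \<open>V\<close> and \<open>W\<close> at the rate
  \<open>- trace_cubic A U V W\<close>. The two summands are the two cyclic orders of three
  factors.\<close>

definition trace_cubic :: "real^'n^'n \<Rightarrow> real^'n^'n \<Rightarrow> real^'n^'n \<Rightarrow> real^'n^'n \<Rightarrow> real" where
  "trace_cubic A U V W =
     trace ((matrix_inv A ** U) ** (matrix_inv A ** V) ** (matrix_inv A ** W)) +
     trace ((matrix_inv A ** U) ** (matrix_inv A ** W) ** (matrix_inv A ** V))"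

lemma trace_mul_rotate: "trace (A ** B ** C) = trace (B ** C ** (A :: real^'n^'n))"
  by (metis matrix_mul_assoc trace_mul_sym)

text \<open>An exchange of two arguments swaps the two cyclic orders, up to rotation under the
  trace. The two exchanges listed generate all permutations.\<close>

lemma trace_cubic_commute:
  "trace_cubic A U V W = trace_cubic A V U W"
  "trace_cubic A U V W = trace_cubic A U W V"
  unfolding trace_cubic_def using trace_mul_rotate by (metis add.commute)+

text \<open>Minus twice the Christoffel term of the Levi-Civita connection, in the standard
  coordinates of the matrix space.\<close>

definition matrix_connection :: "real^'n^'n \<Rightarrow> real^'n^'n \<Rightarrow> real^'n^'n \<Rightarrow> real^'n^'n" where
  "matrix_connection A U V = U ** matrix_inv A ** V + V ** matrix_inv A ** U"

lemmas trace_metric_linear =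
  linear_add[OF bilinear_trace_metric[unfolded bilinear_def, THEN conjunct2, THEN spec]]
  linear_diff[OF bilinear_trace_metric[unfolded bilinear_def, THEN conjunct2, THEN spec]]
  linear_cmul[OF bilinear_trace_metric[unfolded bilinear_def, THEN conjunct2, THEN spec]]
  linear_0[OF bilinear_trace_metric[unfolded bilinear_def, THEN conjunct2, THEN spec]]

text \<open>This raises the last index of the cubic form, so that identities between cubic forms can
  be read as identities between matrices.\<close>

lemma trace_metric_matrix_connection:
  "trace_metric A (matrix_connection A U V) W = trace_cubic A U V W"
proof -
  have "trace_metric A (V ** matrix_inv A ** U) W
      = trace ((matrix_inv A ** V) ** (matrix_inv A ** U) ** (matrix_inv A ** W))" for U V
    by (simp add: trace_metric_alt matrix_mul_assoc)
  then have "trace_metric A (matrix_connection A U V) W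
      = trace ((matrix_inv A ** U) ** (matrix_inv A ** V) ** (matrix_inv A ** W))
        + trace ((matrix_inv A ** V) ** (matrix_inv A ** U) ** (matrix_inv A ** W))"
    by (simp add: matrix_connection_def trace_metric_linear)
  then show ?thesis
    by (simp add: trace_cubic_def trace_mul_rotate[of "matrix_inv A ** V"])
qed

text \<open>The product rule with a moving base point: the two occurrences of the inverse contribute
  one trace of the cubic form each.\<close>

lemma has_derivative_trace_metric:
  fixes p v w :: "'a::real_normed_vector \<Rightarrow> real^'n^'n"
  assumes "p x \<in> GL" and p: "(p has_derivative p') (at x)"
    and v: "(v has_derivative v') (at x)" and w: "(w has_derivative w') (at x)"
  shows "((\<lambda>x. trace_metric (p x) (v x) (w x)) has_derivative
    (\<lambda>h. trace_metric (p x) (v' h) (w x) + trace_metric (p x) (v x) (w' h)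
      - trace_cubic (p x) (p' h) (v x) (w x))) (at x)"
proof -
  define i where "i = (\<lambda>x. matrix_inv (p x))"
  define i' where "i' = (\<lambda>h. - (i x ** p' h ** i x))"
  have i: "(i has_derivative i') (at x)"
    using diff_chain_at[OF p has_derivative_matrix_inv[OF assms(1)]] by (simp add: i_def i'_def o_def)
  have i_x: "matrix_inv (p x) = i x"
    by (simp add: i_def)
  have "((\<lambda>x. trace ((i x ** v x) ** (i x ** w x))) has_derivative
      (\<lambda>h. trace ((i x ** v x) ** (i x ** w' h + i' h ** w x)
        + (i x ** v' h + i' h ** v x) ** (i x ** w x)))) (at x)"
    by (intro bounded_linear.has_derivative[OF bounded_linear_trace]
        bounded_bilinear.FDERIV[OF bounded_bilinear_matrix_mult] i v w)
  moreover have "trace ((i x ** v x) ** (i x ** w' h + i' h ** w x)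
        + (i x ** v' h + i' h ** v x) ** (i x ** w x))
      = trace_metric (p x) (v' h) (w x) + trace_metric (p x) (v x) (w' h)
        - trace_cubic (p x) (p' h) (v x) (w x)" for h
  proof -
    have "trace_cubic (p x) (p' h) (v x) (w x) =
        trace ((i x ** p' h ** i x ** v x) ** (i x ** w x))
        + trace ((i x ** v x) ** (i x ** p' h ** i x ** w x))"
      using trace_mul_rotate[of "i x ** v x" "i x ** p' h" "i x ** w x"]
      by (simp add: trace_cubic_def i_def matrix_mul_assoc)
    then show ?thesis
      by (simp add: trace_metric_alt i_x i'_def matrix_mult_algebra trace_add trace_sub)
  qed
  ultimately show ?thesis
    by (simp add: trace_metric_alt i_def)
qed

text \<open>This is the invariance of the Levi-Civita connection: differentiate the invariance of the metric
  and solve for the second derivative as in the Koszul formula, using its symmetry. Since the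
  derivative of the metric is a totally symmetric trilinear form, the three cyclic
  equations have the same right-hand side.\<close>

lemma isometry_second_derivative:
  fixes f :: "real^'n^'n \<Rightarrow> real^'n^'n"
  assumes "open M" "M \<subseteq> GL" "isometry_of M trace_metric f" "x \<in> M"
  shows "2 *\<^sub>R frechet_derivative (\<lambda>y. frechet_derivative f (at y) v) (at x) u
    = matrix_connection (f x) (frechet_derivative f (at x) u) (frechet_derivative f (at x) v)
      - frechet_derivative f (at x) (matrix_connection x u v)"
proof -
  define F where "F y v = frechet_derivative f (at y) v" for y v
  define H where "H u v = frechet_derivative (\<lambda>y. F y v) (at x) u" for u v
  define h where "h u v w = trace_metric (f x) (H u v) (F x w)" for u v w
  define R where "R u v w = trace_cubic (f x) (F x u) (F x v) (F x w) - trace_cubic x u v w" for u v w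
  have smooth: "smooth_on M f" and bij: "bij_betw f M M"
    and iso: "\<And>p v w. p \<in> M \<Longrightarrow> trace_metric (f p) (F p v) (F p w) = trace_metric p v w"
    using assms(3) by (auto simp: isometry_of_def diffeomorphism_on_def F_def)
  have GL: "x \<in> GL" "f x \<in> GL"
    using assms(2,4) bij_betw_apply[OF bij assms(4)] by auto
  have f: "(f has_derivative F x) (at x)"
    unfolding F_def using smooth_on_has_derivative[OF smooth assms(4)] by simp
  have F: "((\<lambda>y. F y v) has_derivative (\<lambda>u. H u v)) (at x)" for v
    unfolding F_def H_def
    using smooth_on_has_derivative[OF smooth_on_frechet_derivative[OF smooth] assms(4)] by simp
  have lin: "linear (F x)"
    using f has_derivative_linear by blast
  \<comment> \<open>The function \<open>trace_metric y v w\<close> is differentiated twice over: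
    directly, with constant \<open>v\<close> and \<open>w\<close>, and after it is rewritten through
    the isometry.\<close>
  have koszul: "h u v w + h u w v = R u v w" for u v w
  proof -
    have "((\<lambda>y. trace_metric (f y) (F y v) (F y w)) has_derivative
        (\<lambda>u. trace_metric (f x) (H u v) (F x w) + trace_metric (f x) (F x v) (H u w)
          - trace_cubic (f x) (F x u) (F x v) (F x w))) (at x)"
      by (rule has_derivative_trace_metric[OF GL(2) f F F])
    then have "((\<lambda>y. trace_metric y v w) has_derivative
        (\<lambda>u. trace_metric (f x) (H u v) (F x w) + trace_metric (f x) (F x v) (H u w)
          - trace_cubic (f x) (F x u) (F x v) (F x w))) (at x)"
      by (rule has_derivative_transform_within_open[OF _ assms(1,4) iso])
    moreover have "((\<lambda>y. trace_metric y v w) has_derivative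
        (\<lambda>u. trace_metric x 0 w + trace_metric x v 0 - trace_cubic x u v w)) (at x)"
      by (rule has_derivative_trace_metric[where p = "\<lambda>y. y" and v = "\<lambda>_. v" and w = "\<lambda>_. w"])
        (use GL in auto)
    ultimately have "trace_metric (f x) (H u v) (F x w) + trace_metric (f x) (F x v) (H u w)
        - trace_cubic (f x) (F x u) (F x v) (F x w)
        = trace_metric x 0 w + trace_metric x v 0 - trace_cubic x u v w"
      by (metis (mono_tags, lifting) has_derivative_unique)
    moreover have "trace_metric x 0 w = 0" "trace_metric x v 0 = 0"
      by (simp_all add: trace_metric_linear trace_metric_sym[of x v])
    ultimately show ?thesis
      by (simp add: h_def R_def trace_metric_sym[of "f x" "F x v"])
  qed
  have h_sym: "h u v w = h v u w" for u v w
    using frechet_derivative_commute[OF assms(1) smooth assms(4)]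
    by (simp add: h_def H_def F_def)
  have R_sym: "R v u w = R u v w" "R w u v = R u v w" for u v w
    using trace_cubic_commute(1)[of _ v u w] trace_cubic_commute(1)[of _ w u v]
      trace_cubic_commute(2)[of _ u w v] trace_cubic_commute(1)[of "f x" "F x v" "F x u" "F x w"]
      trace_cubic_commute(1)[of "f x" "F x w" "F x u" "F x v"]
      trace_cubic_commute(2)[of "f x" "F x u" "F x w" "F x v"]
    by (simp_all add: R_def)
  \<comment> \<open>Add the first two instances of \<open>koszul\<close> and subtract the third. By
    symmetry of \<open>h\<close> in its first two arguments the mixed terms cancel in pairs, and the
    total symmetry of \<open>R\<close> merges the right-hand sides.\<close>
  have "2 * h u v w = R u v w" for w
    using koszul[of u v w] koszul[of v u w] koszul[of w u v] h_sym[of v u w] h_sym[of w u v]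
      h_sym[of w v u] R_sym[of v u w] R_sym[of w u v]
    by simp
  then have "trace_metric (f x) (2 *\<^sub>R H u v - (matrix_connection (f x) (F x u) (F x v)
      - F x (matrix_connection x u v))) (F x w) = 0" for w
    using iso[OF assms(4), of "matrix_connection x u v" w]
    by (simp add: trace_metric_linear trace_metric_matrix_connection h_def R_def)
  \<comment> \<open>So far the identity is tested only against vectors \<open>F x w\<close>. A
    differential that preserves a nondegenerate form is injective, hence onto, and all test vectors
    are reached.\<close>
  moreover have "surj (F x)"
  proof (rule linear_inj_imp_surj[OF lin], rule linear_injective_0[OF lin, THEN iffD2], intro allI impI)
    fix v assume "F x v = 0"
    then have "trace_metric x v w = 0" for w
      using iso[OF assms(4), of v w] by (simp add: trace_metric_linear)
    then show "v = 0"
      using nondegenerate_trace_metric[OF GL(1)] by (auto simp: nondegenerate_form_def)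
  qed
  ultimately have "trace_metric (f x) (2 *\<^sub>R H u v - (matrix_connection (f x) (F x u) (F x v)
      - F x (matrix_connection x u v))) W = 0" for W
    by (metis surjD)
  then have "2 *\<^sub>R H u v - (matrix_connection (f x) (F x u) (F x v) - F x (matrix_connection x u v)) = 0"
    using nondegenerate_trace_metric[OF GL(2)] unfolding nondegenerate_form_def by blast
  then show ?thesis
    by (simp add: H_def F_def)
qed

section \<open>Lipschitz estimates for the connection term\<close>

lemma matrix_triple_product_bound:
  obtains k where "0 \<le> k" "\<And>A B C (a::real) b c. \<lbrakk>norm A \<le> a; norm B \<le> b; norm C \<le> c\<rbrakk>
    \<Longrightarrow> norm ((A :: real^'n^'n) ** (B :: real^'n^'n) ** (C :: real^'n^'n)) \<le> k * a * b * c"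
proof -
  obtain K where K: "K \<ge> 0" "\<And>(B :: real^'n^'n) (C :: real^'n^'n). norm (B ** C) \<le> norm B * norm C * K"
    using bounded_bilinear.nonneg_bounded[OF bounded_bilinear_matrix_mult] by blast
  have "norm (A ** B ** C) \<le> (K * K) * a * b * c"
    if "norm A \<le> a" "norm B \<le> b" "norm C \<le> c" for A B C :: "real^'n^'n" and a b c
  proof -
    have nonneg: "0 \<le> a" "0 \<le> b" "0 \<le> c"
      using that norm_ge_zero order_trans by blast+
    have "norm (A ** B ** C) \<le> norm (A ** B) * norm C * K"
      by (rule K)
    also have "\<dots> \<le> (norm A * norm B * K) * norm C * K"
      using K by (intro mult_right_mono) auto
    also have "\<dots> \<le> (a * b * K) * c * K"
      using that nonneg K(1) by (intro mult_right_mono mult_mono) auto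
    finally show ?thesis
      by (simp add: algebra_simps)
  qed
  then show ?thesis
    using that[of "K * K"] K(1) by simp
qed

text \<open>Telescoping changes one factor of the triple product at a time. The middle factor is
  handled by y1^-1 - y2^-1 = y1^-1 (y2 - y1) y2^-1, so bounds on the inverses suffice.\<close>

lemma matrix_connection_lipschitz:
  fixes C :: real
  obtains L where "0 \<le> L"
    "\<And>y1 y2 U1 U2 V1 V2 (e::real). \<lbrakk>y1 \<in> GL; y2 \<in> GL; norm (matrix_inv y1) \<le> C; norm (matrix_inv y2) \<le> C;
      norm U1 \<le> C; norm U2 \<le> C; norm V1 \<le> C; norm V2 \<le> C;
      norm (y1 - y2) \<le> e; norm (U1 - U2) \<le> e; norm (V1 - V2) \<le> e\<rbrakk>
    \<Longrightarrow> norm (matrix_connection y1 U1 V1 - matrix_connection y2 U2 (V2 :: real^'n^'n)) \<le> L * e"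
proof -
  obtain k where k: "0 \<le> k" "\<And>A B C (a::real) b c. \<lbrakk>norm A \<le> a; norm B \<le> b; norm C \<le> c\<rbrakk>
    \<Longrightarrow> norm ((A :: real^'n^'n) ** (B :: real^'n^'n) ** (C :: real^'n^'n)) \<le> k * a * b * c"
    using matrix_triple_product_bound by blast
  \<comment> \<open>One summand per factor that changes; the inner \<open>k * C * C\<close> is the
    Lipschitz constant of inversion.\<close>
  define L where "L = k * C * C + k * C * (k * C * C) * C + k * C * C"
  have triple: "norm (U1 ** matrix_inv y1 ** V1 - U2 ** matrix_inv y2 ** V2) \<le> L * e"
    if "y1 \<in> GL" "y2 \<in> GL" "norm (matrix_inv y1) \<le> C" "norm (matrix_inv y2) \<le> C"
      "norm U2 \<le> C" "norm V1 \<le> C"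
      "norm (y1 - y2) \<le> e" "norm (U1 - U2) \<le> e" "norm (V1 - V2) \<le> e"
    for y1 y2 U1 U2 V1 V2 :: "real^'n^'n" and e
  proof -
    have inv_diff: "matrix_inv y1 - matrix_inv y2 = matrix_inv y1 ** (y2 - y1) ** matrix_inv y2"
      using that by (simp add: matrix_mult_algebra matrix_inv_cancel)
    have "norm (matrix_inv y1 - matrix_inv y2) \<le> k * C * e * C"
      unfolding inv_diff using that by (intro k) (auto simp: norm_minus_commute)
    then have "norm ((U1 - U2) ** matrix_inv y1 ** V1) \<le> k * e * C * C"
      "norm (U2 ** (matrix_inv y1 - matrix_inv y2) ** V1) \<le> k * C * (k * C * e * C) * C"
      "norm (U2 ** matrix_inv y2 ** (V1 - V2)) \<le> k * C * C * e"
      using that by (auto intro!: k)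
    moreover have "U1 ** matrix_inv y1 ** V1 - U2 ** matrix_inv y2 ** V2 =
        (U1 - U2) ** matrix_inv y1 ** V1 + U2 ** (matrix_inv y1 - matrix_inv y2) ** V1
        + U2 ** matrix_inv y2 ** (V1 - V2)"
      by (simp add: matrix_mult_algebra)
    ultimately have "norm (U1 ** matrix_inv y1 ** V1 - U2 ** matrix_inv y2 ** V2)
        \<le> k * e * C * C + k * C * (k * C * e * C) * C + k * C * C * e"
      using norm_triangle_mono by (metis (no_types, lifting))
    then show ?thesis
      by (simp add: L_def algebra_simps)
  qed
  \<comment> \<open>Only even powers of \<open>C\<close> occur, so the sign of \<open>C\<close> does
    not matter.\<close>
  have "L = 2 * k * C\<^sup>2 + k\<^sup>2 * (C\<^sup>2)\<^sup>2"
    by (simp add: L_def power2_eq_square)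
  then have "L \<ge> 0"
    using k(1) by simp
  moreover have "norm (matrix_connection y1 U1 V1 - matrix_connection y2 U2 V2) \<le> 2 * L * e"
    if "y1 \<in> GL" "y2 \<in> GL" "norm (matrix_inv y1) \<le> C" "norm (matrix_inv y2) \<le> C"
      "norm U1 \<le> C" "norm U2 \<le> C" "norm V1 \<le> C" "norm V2 \<le> C"
      "norm (y1 - y2) \<le> e" "norm (U1 - U2) \<le> e" "norm (V1 - V2) \<le> e"
    for y1 y2 U1 U2 V1 V2 :: "real^'n^'n" and e
  proof -
    have "matrix_connection y1 U1 V1 - matrix_connection y2 U2 V2 =
        (U1 ** matrix_inv y1 ** V1 - U2 ** matrix_inv y2 ** V2)
        + (V1 ** matrix_inv y1 ** U1 - V2 ** matrix_inv y2 ** U2)"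
      by (simp add: matrix_connection_def)
    moreover have "norm (U1 ** matrix_inv y1 ** V1 - U2 ** matrix_inv y2 ** V2) \<le> L * e"
      "norm (V1 ** matrix_inv y1 ** U1 - V2 ** matrix_inv y2 ** U2) \<le> L * e"
      using that by (auto intro: triple)
    ultimately show ?thesis
      using norm_triangle_mono by fastforce
  qed
  ultimately show ?thesis
    using that[of "2 * L"] by simp
qed

lemma norm_linear_le_sum_Basis:
  fixes D :: "'a::euclidean_space \<Rightarrow> 'b::real_normed_vector"
  assumes "linear D"
  shows "norm (D w) \<le> norm w * (\<Sum>b\<in>Basis. norm (D b))"
proof -
  have "D w = D (\<Sum>b\<in>Basis. (w \<bullet> b) *\<^sub>R b)"
    by (simp only: euclidean_representation)
  also have "\<dots> = (\<Sum>b\<in>Basis. (w \<bullet> b) *\<^sub>R D b)"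
    by (simp only: linear_sum[OF assms] linear_cmul[OF assms])
  also have "norm \<dots> \<le> (\<Sum>b\<in>Basis. \<bar>w \<bullet> b\<bar> * norm (D b))"
    by (rule order_trans[OF norm_sum]) simp
  also have "\<dots> \<le> (\<Sum>b\<in>Basis. norm w * norm (D b))"
    by (intro sum_mono mult_right_mono Basis_le_norm) auto
  finally show ?thesis
    by (simp add: sum_distrib_left)
qed

text \<open>Unique continuation is applied to the difference of the maps together with the
  differences of their partial derivatives. The derivative of the first member lies in the family,
  and those of the others are expressed through it by
  \<open>isometry_second_derivative\<close>.\<close>

lemma isometry_unique:
  fixes f1 f2 :: "real^'n^'n \<Rightarrow> real^'n^'n"
  assumes "open M" "connected M" "M \<subseteq> GL"
    and iso: "isometry_of M trace_metric f1" "isometry_of M trace_metric f2"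
    and "p \<in> M" "f1 p = f2 p" "\<And>v. frechet_derivative f1 (at p) v = frechet_derivative f2 (at p) v"
    and "x \<in> M"
  shows "f1 x = f2 x"
proof -
  define F1 where "F1 v y = frechet_derivative f1 (at y) v" for v y
  define F2 where "F2 v y = frechet_derivative f2 (at y) v" for v y
  define H1 where "H1 v y = frechet_derivative (F1 v) (at y)" for v y
  define H2 where "H2 v y = frechet_derivative (F2 v) (at y)" for v y
  \<comment> \<open>The index 0 stands for the values and a basis matrix for the partial derivative
    in its direction; there is no clash, as basis elements are nonzero.\<close>
  define c where "c i = (if i = 0 then (\<lambda>y. f1 y - f2 y) else (\<lambda>y. F1 i y - F2 i y))" for i
  define c' where "c' i y = (if i = 0 then (\<lambda>u. F1 u y - F2 u y) else (\<lambda>u. H1 i y u - H2 i y u))" for i y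
  have smooth: "smooth_on M f1" "smooth_on M f2" "smooth_on M (F1 v)" "smooth_on M (F2 v)" for v
    using iso smooth_on_frechet_derivative
    by (auto simp: isometry_of_def diffeomorphism_on_def F1_def[abs_def] F2_def[abs_def])
  have GL: "f1 y \<in> GL" "f2 y \<in> GL" "y \<in> GL" if "y \<in> M" for y
    using iso assms(3) that by (auto simp: isometry_of_def diffeomorphism_on_def bij_betw_def)
  have f: "(f1 has_derivative (\<lambda>u. F1 u y)) (at y)" "(f2 has_derivative (\<lambda>u. F2 u y)) (at y)"
    if "y \<in> M" for y
    using smooth_on_has_derivative[OF _ that] smooth by (auto simp: F1_def F2_def)
  have F: "(F1 v has_derivative H1 v y) (at y)" "(F2 v has_derivative H2 v y) (at y)" if "y \<in> M" for v y
    using smooth_on_has_derivative[OF _ that] smooth by (auto simp: H1_def H2_def)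
  have second: "2 *\<^sub>R H1 v y u = matrix_connection (f1 y) (F1 u y) (F1 v y) - F1 (matrix_connection y u v) y"
    "2 *\<^sub>R H2 v y u = matrix_connection (f2 y) (F2 u y) (F2 v y) - F2 (matrix_connection y u v) y"
    if "y \<in> M" for u v y
    using isometry_second_derivative[OF assms(1,3) iso(1) that]
      isometry_second_derivative[OF assms(1,3) iso(2) that]
    by (simp_all add: H1_def H2_def F1_def[abs_def] F2_def[abs_def])
  have "c 0 x = 0"
  proof (rule unique_continuation[OF assms(1,2), of "insert 0 Basis" c c' p 0 x])
    show "(c i has_derivative c' i y) (at y)" if "y \<in> M" for i y
      using f[OF that] F[OF that] by (auto simp: c_def c'_def intro: has_derivative_diff)
    show "c i p = 0" for i
      using assms(7,8) by (simp add: c_def F1_def F2_def)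
    show "\<exists>r>0. \<exists>K. \<forall>y \<in> ball q r \<inter> M. \<forall>i\<in>insert 0 Basis. \<forall>u\<in>Basis.
        norm (c' i y u) \<le> K * (\<Sum>j\<in>insert 0 Basis. norm (c j y))" if "q \<in> M" for q
    proof -
      define e where "e y = (\<Sum>j\<in>insert 0 Basis. norm (c j y))" for y
      \<comment> \<open>One continuous function dominates every inverse and every partial derivative
        in the estimates, so a single compactness argument yields the common bound
        \<open>C\<close>.\<close>
      define N where "N y = norm (matrix_inv y) + norm (matrix_inv (f1 y)) + norm (matrix_inv (f2 y))
        + (\<Sum>b\<in>Basis. norm (F1 b y)) + (\<Sum>b\<in>Basis. norm (F2 b y))" for y
      have e_eq: "e y = norm (f1 y - f2 y) + (\<Sum>b\<in>Basis. norm (F1 b y - F2 b y))" for y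
        unfolding e_def by (subst sum.insert) (auto simp: c_def intro!: sum.cong)
      obtain r where r: "r > 0" "cball q r \<subseteq> M"
        using assms(1) \<open>q \<in> M\<close> open_contains_cball by blast
      have "continuous_on M N"
        unfolding N_def using smooth GL
        by (intro continuous_intros continuous_on_compose2[OF continuous_on_matrix_inv]
            smooth_on_continuous) auto
      then have "bounded (N ` cball q r)"
        using r(2) by (intro compact_imp_bounded compact_continuous_image)
          (auto intro: continuous_on_subset)
      then obtain C where C: "\<And>y. y \<in> cball q r \<Longrightarrow> norm (N y) \<le> C"
        unfolding bounded_iff by blast
      obtain L where L: "0 \<le> L"
        "\<And>y1 y2 U1 U2 V1 V2 (e::real). \<lbrakk>y1 \<in> GL; y2 \<in> GL; norm (matrix_inv y1) \<le> C; norm (matrix_inv y2) \<le> C;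
          norm U1 \<le> C; norm U2 \<le> C; norm V1 \<le> C; norm V2 \<le> C;
          norm (y1 - y2) \<le> e; norm (U1 - U2) \<le> e; norm (V1 - V2) \<le> e\<rbrakk>
        \<Longrightarrow> norm (matrix_connection y1 U1 V1 - matrix_connection y2 U2 (V2 :: real^'n^'n)) \<le> L * e"
        using matrix_connection_lipschitz by blast
      obtain k where k: "0 \<le> k" "\<And>A B C (a::real) b c. \<lbrakk>norm A \<le> a; norm B \<le> b; norm C \<le> c\<rbrakk>
          \<Longrightarrow> norm ((A :: real^'n^'n) ** (B :: real^'n^'n) ** (C :: real^'n^'n)) \<le> k * a * b * c"
        using matrix_triple_product_bound by blast
      \<comment> \<open>The summand 1 serves the index 0, \<open>L\<close> bounds the difference of
        the connection terms at the two image points, and \<open>2 * k * C\<close> bounds the norm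
        of \<open>w\<close> below.\<close>
      have "norm (c' i y u) \<le> (1 + L + 2 * k * C) * e y"
        if y: "y \<in> ball q r" and i: "i \<in> insert 0 Basis" and u: "u \<in> Basis" for y i u
      proof -
        have "y \<in> M" "y \<in> cball q r"
          using y r by auto
        have e_nonneg: "0 \<le> e y"
          by (simp add: e_def sum_nonneg)
        have diff_F: "norm (F1 b y - F2 b y) \<le> e y" if "b \<in> Basis" for b
          using member_le_sum[OF that, of "\<lambda>b. norm (F1 b y - F2 b y)"] by (simp add: e_eq add_increasing)
        have F_le_sum: "norm (F1 b y) \<le> (\<Sum>b\<in>Basis. norm (F1 b y))"
          "norm (F2 b y) \<le> (\<Sum>b\<in>Basis. norm (F2 b y))" if "b \<in> Basis" for b
          by (intro member_le_sum[OF that]; simp)+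
        have sums: "0 \<le> (\<Sum>b\<in>Basis. norm (F1 b y))" "0 \<le> (\<Sum>b\<in>Basis. norm (F2 b y))"
          by (auto intro: sum_nonneg)
        have bounds: "norm (matrix_inv y) \<le> C" "norm (matrix_inv (f1 y)) \<le> C" "norm (matrix_inv (f2 y)) \<le> C"
          using C[OF \<open>y \<in> cball q r\<close>] sums norm_ge_zero[of "matrix_inv y"]
            norm_ge_zero[of "matrix_inv (f1 y)"] norm_ge_zero[of "matrix_inv (f2 y)"]
          unfolding N_def real_norm_def by linarith+
        have F_bounds: "norm (F1 b y) \<le> C" "norm (F2 b y) \<le> C" if "b \<in> Basis" for b
          using C[OF \<open>y \<in> cball q r\<close>] sums F_le_sum[OF that] norm_ge_zero[of "matrix_inv y"]
            norm_ge_zero[of "matrix_inv (f1 y)"] norm_ge_zero[of "matrix_inv (f2 y)"]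
          unfolding N_def real_norm_def by linarith+
        have "0 \<le> C"
          using bounds(1) norm_ge_zero order_trans by blast
        show ?thesis
        proof (cases "i = 0")
          case True
          have "norm (c' i y u) \<le> 1 * e y"
            using diff_F[OF u] by (simp add: c'_def True)
          also have "\<dots> \<le> (1 + L + 2 * k * C) * e y"
            using L(1) k(1) \<open>0 \<le> C\<close> e_nonneg by (intro mult_right_mono) auto
          finally show ?thesis .
        next
          case False
          then have i: "i \<in> Basis"
            using i by simp
          \<comment> \<open>This vector depends on the common point \<open>y\<close> only, so it is
            the same for both maps, and the last term of the equation contributes only the
            difference of the differentials at \<open>w\<close>.\<close>
          define w where "w = matrix_connection y u i"
          have connection: "norm (matrix_connection (f1 y) (F1 u y) (F1 i y)
              - matrix_connection (f2 y) (F2 u y) (F2 i y)) \<le> L * e y"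
            using GL[OF \<open>y \<in> M\<close>] bounds F_bounds[OF u] F_bounds[OF i] diff_F[OF u] diff_F[OF i]
            by (intro L) (auto simp: e_eq sum_nonneg)
          have "linear (\<lambda>u. F1 u y - F2 u y)"
            using f[OF \<open>y \<in> M\<close>] has_derivative_linear linear_compose_sub by blast
          then have "norm (F1 w y - F2 w y) \<le> norm w * (\<Sum>b\<in>Basis. norm (F1 b y - F2 b y))"
            by (rule norm_linear_le_sum_Basis)
          also have "\<dots> \<le> norm w * e y"
            by (intro mult_left_mono) (auto simp: e_eq)
          also have "norm w \<le> 2 * k * C"
          proof -
            have "norm (u ** matrix_inv y ** i) \<le> k * 1 * C * 1" "norm (i ** matrix_inv y ** u) \<le> k * 1 * C * 1"
              using u i bounds(1) by (intro k; simp)+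
            then have "norm (u ** matrix_inv y ** i + i ** matrix_inv y ** u) \<le> k * 1 * C * 1 + k * 1 * C * 1"
              by (rule norm_triangle_mono)
            then show ?thesis
              by (simp add: w_def matrix_connection_def mult_ac)
          qed
          finally have linear_part: "norm (F1 w y - F2 w y) \<le> 2 * k * C * e y"
            using e_nonneg by (simp add: mult_right_mono)
          \<comment> \<open>The factor 2 is given away in order to match the left-hand side of
            \<open>second\<close>.\<close>
          have "norm (c' i y u) \<le> norm (2 *\<^sub>R H1 i y u - 2 *\<^sub>R H2 i y u)"
            by (simp add: c'_def False flip: scaleR_diff_right)
          also have "\<dots> = norm ((matrix_connection (f1 y) (F1 u y) (F1 i y)
              - matrix_connection (f2 y) (F2 u y) (F2 i y)) - (F1 w y - F2 w y))"
            unfolding second[OF \<open>y \<in> M\<close>] w_def by (simp add: algebra_simps)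
          also have "\<dots> \<le> L * e y + 2 * k * C * e y"
            using connection linear_part norm_triangle_ineq4 add_mono order_trans by metis
          also have "\<dots> \<le> (1 + L + 2 * k * C) * e y"
            using e_nonneg by (simp add: algebra_simps)
          finally show ?thesis .
        qed
      qed
      with r(1) show ?thesis
        unfolding e_def by blast
    qed
  qed (use assms in auto)
  then show ?thesis
    by (simp add: c_def)
qed

section \<open>Connectedness of the two components\<close>

text \<open>With this, connections of the factors combine to a connection of their product.\<close>

lemma connected_component_GL_mult:
  fixes A B C :: "real^'n^'n"
  assumes "connected_component GL A B" "C \<in> GL"
  shows "connected_component GL (C ** A) (C ** B)" "connected_component GL (A ** C) (B ** C)"
proof -
  obtain T where T: "connected T" "T \<subseteq> GL" "A \<in> T" "B \<in> T"
    using assms(1) by (auto simp: connected_component_def)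
  have "connected ((\<lambda>X. C ** X) ` T)" "connected ((\<lambda>X. X ** C) ` T)"
    by (intro connected_continuous_image T linear_continuous_on
        bounded_bilinear.bounded_linear_left[OF bounded_bilinear_matrix_mult]
        bounded_bilinear.bounded_linear_right[OF bounded_bilinear_matrix_mult])+
  then show "connected_component GL (C ** A) (C ** B)" "connected_component GL (A ** C) (B ** C)"
    using T assms(2) unfolding connected_component_def
    by (blast intro: matrix_mult_in_GL)+
qed

section \<open>Hyperplane reflections and diagonal scalings\<close>

text \<open>The Householder matrix of \<open>u\<close>, depending only on the line spanned by
  \<open>u\<close>.\<close>

definition reflection :: "real^'n \<Rightarrow> real^'n^'n" where
  "reflection u = mat 1 - (2 / (u \<bullet> u)) *\<^sub>R (\<chi> i j. u $ i * u $ j)"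

text \<open>The rank-one matrix \<open>P\<close> satisfies P^2 = (u . u) P, so the linear and the
  quadratic term cancel.\<close>

lemma reflection_involution:
  assumes "u \<noteq> 0"
  shows "reflection u ** reflection u = mat 1"
proof -
  define P where "P = (\<chi> i j. u $ i * u $ j)"
  have P: "P ** P = (u \<bullet> u) *\<^sub>R P"
    by (simp add: P_def matrix_matrix_mult_def vec_eq_iff inner_vec_def sum_distrib_left sum_distrib_right mult_ac)
  have "reflection u ** reflection u
      = mat 1 - (2 * (2 / (u \<bullet> u))) *\<^sub>R P + ((2 / (u \<bullet> u)) * (2 / (u \<bullet> u)) * (u \<bullet> u)) *\<^sub>R P"
    by (simp add: reflection_def P_def[symmetric] matrix_mult_algebra P algebra_simps
        flip: scaleR_2)
  then show ?thesis
    using assms by simp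
qed

lemma reflection_in_GL: "u \<noteq> 0 \<Longrightarrow> reflection u \<in> GL"
  using reflection_involution by (auto simp: GL_def invertible_right_inverse)

lemma reflection_scaleR: "c \<noteq> 0 \<Longrightarrow> reflection (c *\<^sub>R u) = reflection u"
  by (simp add: reflection_def vec_eq_iff field_simps)

lemma continuous_on_reflection: "continuous_on (- {0}) (reflection :: real^'n \<Rightarrow> real^'n^'n)"
  unfolding reflection_def
  by (intro continuous_intros continuous_on_vec_lambda) auto

text \<open>Move the normal vector along the segment from \<open>u\<close> to \<open>w\<close>. If
  the segment meets 0, the vectors are proportional and the reflections equal; this also settles
  dimension one, where the nonzero vectors are not connected.\<close>

lemma connected_component_reflection:
  assumes "u \<noteq> 0" "w \<noteq> 0"
  shows "connected_component GL (reflection u) (reflection w)"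
proof (cases "0 \<in> closed_segment u w")
  case True
  then obtain t where t: "0 = (1 - t) *\<^sub>R u + t *\<^sub>R w" "0 \<le> t" "t \<le> 1"
    by (auto simp: in_segment)
  have "t \<noteq> 0" "t \<noteq> 1"
    using t(1) assms by auto
  have "t *\<^sub>R w = (- (1 - t)) *\<^sub>R u"
    using t(1) by (simp add: algebra_simps eq_neg_iff_add_eq_0)
  then have "reflection (t *\<^sub>R w) = reflection ((- (1 - t)) *\<^sub>R u)"
    by simp
  then have "reflection w = reflection u"
    using \<open>t \<noteq> 0\<close> \<open>t \<noteq> 1\<close> by (simp only: reflection_scaleR) (simp add: reflection_scaleR)
  then show ?thesis
    using reflection_in_GL[OF assms(1)] by simp
next
  case False
  have "connected (reflection ` closed_segment u w)"
    using False
    by (intro connected_continuous_image continuous_on_subset[OF continuous_on_reflection]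
        connected_segment) auto
  moreover have "reflection ` closed_segment u w \<subseteq> GL"
    using False by (auto intro!: reflection_in_GL)
  ultimately show ?thesis
    unfolding connected_component_def by blast
qed

definition diagonal_unit :: "'n \<Rightarrow> real \<Rightarrow> real^'n^'n" where
  "diagonal_unit k c = (\<chi> i j. if i = j then if i = k then c else 1 else 0)"

lemma det_diagonal_unit: "det (diagonal_unit k c) = c"
proof -
  have "det (diagonal_unit k c) = (\<Prod>i\<in>UNIV. if i = k then c else 1)"
    by (subst det_diagonal) (auto simp: diagonal_unit_def)
  then show ?thesis
    by simp
qed

lemma diagonal_unit_mult: "(diagonal_unit k c ** B) $ i $ j = (if i = k then c else 1) * B $ i $ j"
proof -
  have "(diagonal_unit k c ** B) $ i $ j
      = (\<Sum>l\<in>UNIV. if i = l then (if i = k then c else 1) * B $ l $ j else 0)"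
    unfolding matrix_matrix_mult_def diagonal_unit_def vec_lambda_beta by (rule sum.cong) auto
  then show ?thesis
    by simp
qed

lemma diagonal_unit_eq_reflection: "diagonal_unit k (-1) = reflection (axis k 1)"
proof -
  have "axis k (1::real) $ i = (if i = k then 1 else 0)" for i
    by (simp add: axis_def)
  then show ?thesis
    by (auto simp: diagonal_unit_def reflection_def vec_eq_iff mat_def inner_axis_axis)
qed

text \<open>Numbers of equal sign are joined by a segment that avoids 0, and the determinant of
  \<open>diagonal_unit k c\<close> is \<open>c\<close>.\<close>

lemma connected_component_diagonal_unit:
  assumes "c * d > 0"
  shows "connected_component GL (diagonal_unit k c) (diagonal_unit k d)"
proof -
  have "0 \<notin> closed_segment c d"
    using assms by (auto simp: closed_segment_eq_real_ivl zero_less_mult_iff split: if_splits)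
  then have "diagonal_unit k ` closed_segment c d \<subseteq> GL"
    by (auto simp: GL_eq_det det_diagonal_unit)
  moreover have "continuous_on S (\<lambda>c. if i = j then if i = k then c else 1 else (0::real))" for S i j
    by (cases "i = j"; cases "i = k") (auto intro: continuous_intros)
  then have "connected (diagonal_unit k ` closed_segment c d)"
    unfolding diagonal_unit_def
    by (intro connected_continuous_image continuous_on_vec_lambda connected_segment)
  ultimately show ?thesis
    unfolding connected_component_def by blast
qed

text \<open>Elementary matrices generate: a shear is joined to the identity, while transpositions and negative
  diagonal scalings are joined to reflections, which are all joined to each other.\<close>

lemma connected_component_GL_cases:
  fixes A :: "real^'n^'n" and k :: 'n
  assumes "A \<in> GL"
  shows "connected_component GL A (mat 1) \<or> connected_component GL A (reflection (axis k 1))"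
proof -
  define J :: "real^'n^'n" where "J = reflection (axis k 1)"
  \<comment> \<open>The induction over elementary matrices also meets singular matrices, for which
    the implication makes \<open>P\<close> vacuous.\<close>
  define P where "P A \<longleftrightarrow> (A \<in> GL \<longrightarrow> connected_component GL A (mat 1) \<or> connected_component GL A J)"
    for A
  have J: "J ** J = mat 1" "J \<in> GL"
    unfolding J_def by (auto intro: reflection_involution reflection_in_GL)
  \<comment> \<open>Closure under products reduces to the two representatives, which form a group
    because \<open>J\<close> is an involution.\<close>
  have mult: "P (A ** B)" if P: "P A" "P B" for A B
    unfolding P_def
  proof
    assume "A ** B \<in> GL"
    then have AB: "A \<in> GL" "B \<in> GL"
      by (auto simp: GL_eq_det det_mul)
    then obtain X Y where X: "connected_component GL A X" "X \<in> {mat 1, J}"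
      and Y: "connected_component GL B Y" "Y \<in> {mat 1, J}"
      using P unfolding P_def by blast
    have "X \<in> GL"
      using X(1) connected_component_in by blast
    have "connected_component GL (A ** B) (X ** Y)"
      using connected_component_GL_mult(2)[OF X(1) AB(2)] connected_component_GL_mult(1)[OF Y(1) \<open>X \<in> GL\<close>]
      by (rule connected_component_trans)
    moreover have "X ** Y \<in> {mat 1, J}"
      using X(2) Y(2) J by auto
    ultimately show "connected_component GL (A ** B) (mat 1) \<or> connected_component GL (A ** B) J"
      by auto
  qed
  have refl: "P (reflection u)" if "u \<noteq> 0" for u
    using connected_component_reflection[OF that, of "axis k 1"] by (simp add: P_def J_def)
  have mat_1: "P (mat 1)"
    using mat_1_in_GL by (simp add: P_def)
  have unit: "P (diagonal_unit l c)" for l c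
  proof (cases "c > 0")
    case True
    have "diagonal_unit l 1 = (mat 1 :: real^'n^'n)"
      by (simp add: diagonal_unit_def mat_def vec_eq_iff)
    then show ?thesis
      using connected_component_diagonal_unit[of c 1 l] True by (simp add: P_def)
  next
    case False
    show ?thesis
      unfolding P_def
    proof
      assume "diagonal_unit l c \<in> GL"
      then have "c < 0"
        using False by (simp add: GL_eq_det det_diagonal_unit)
      then have "connected_component GL (diagonal_unit l c) (reflection (axis l 1))"
        using connected_component_diagonal_unit[of c "-1" l] by (simp add: diagonal_unit_eq_reflection)
      moreover have "connected_component GL (reflection (axis l 1)) J"
        unfolding J_def by (rule connected_component_reflection) auto
      ultimately show "connected_component GL (diagonal_unit l c) (mat 1)
          \<or> connected_component GL (diagonal_unit l c) J"
        using connected_component_trans by blast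
    qed
  qed
  have "P A"
  proof (induction A rule: induct_matrix_elementary)
    case (1 A B)
    then show ?case
      by (rule mult)
  next
    case (2 A i)
    then show ?case
      using det_zero_row(2)[of i A] by (simp add: P_def GL_eq_det)
  next
    case (3 A)
    \<comment> \<open>A diagonal matrix is built up one diagonal entry at a time, as a product of
      \<open>diagonal_unit\<close> factors.\<close>
    define D where "D S = (\<chi> i j. if i = j then if i \<in> S then A $ i $ i else 1 else 0)" for S
    have "P (D S)" if "finite S" for S
      using that
    proof (induction S)
      case empty
      have "D {} = mat 1"
        by (simp add: D_def mat_def vec_eq_iff)
      then show ?case
        using mat_1 by simp
    next
      case (insert l S)
      have "D (insert l S) = diagonal_unit l (A $ l $ l) ** D S"
        using insert.hyps(2)
        by (auto simp: vec_eq_iff diagonal_unit_mult D_def)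
      then show ?case
        using mult[OF unit insert.IH] by simp
    qed
    moreover have "D UNIV = A"
      using 3 by (auto simp: D_def vec_eq_iff)
    ultimately show ?case
      by (metis finite)
  next
    case (4 m n)
    \<comment> \<open>Swapping two coordinates is the reflection that negates the difference of
      their unit vectors.\<close>
    define u :: "real^'n" where "u = axis m 1 - axis n 1"
    have "u \<bullet> u = 2"
      using 4 by (simp add: u_def inner_diff_left inner_diff_right inner_axis_axis)
    moreover have "u $ i = (if i = m then 1 else 0) - (if i = n then 1 else 0)" for i
      by (auto simp: u_def axis_def)
    ultimately have "(\<chi> i j. mat 1 $ i $ Transposition.transpose m n j) = reflection u"
      using 4 by (auto simp: reflection_def vec_eq_iff mat_def Transposition.transpose_def)
    moreover have "u \<noteq> 0"
      using \<open>u \<bullet> u = 2\<close> by auto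
    ultimately show ?case
      using refl by simp
  next
    case (5 m n c)
    define N :: "real^'n^'n" where "N = (\<chi> i j. of_bool (i = m \<and> j = n))"
    define T where "T = range (\<lambda>t. mat 1 + t *\<^sub>R N)"
    \<comment> \<open>As \<open>m\<close> and \<open>n\<close> differ, \<open>N\<close> is
      nilpotent, so \<open>mat 1 - t *\<^sub>R N\<close> inverts
      \<open>mat 1 + t *\<^sub>R N\<close> for every \<open>t\<close> and the whole line stays
      invertible.\<close>
    have "N ** N = 0"
      using 5 by (auto simp: N_def matrix_matrix_mult_def vec_eq_iff)
    then have "(mat 1 + t *\<^sub>R N) ** (mat 1 - t *\<^sub>R N) = mat 1" for t
      by (simp add: matrix_mult_algebra)
    then have "T \<subseteq> GL"
      by (auto simp: T_def GL_def invertible_right_inverse)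
    moreover have "connected T"
      unfolding T_def by (intro connected_continuous_image continuous_intros) auto
    moreover have "(\<chi> i j. if i = m \<and> j = n then c else of_bool (i = j)) = mat 1 + c *\<^sub>R N"
      using 5 by (auto simp: N_def mat_def vec_eq_iff)
    then have "(\<chi> i j. if i = m \<and> j = n then c else of_bool (i = j)) \<in> T"
      by (auto simp: T_def)
    moreover have "mat 1 \<in> T"
      unfolding T_def by (rule range_eqI[of _ _ 0]) simp
    ultimately show ?case
      unfolding P_def connected_component_def by blast
  qed
  with assms show ?thesis
    by (simp add: P_def J_def)
qed

section \<open>Separating the components by the sign of the determinant\<close>

text \<open>This upgrades connections inside the whole group to connections inside one
  component.\<close>

lemma connected_subset_GL_pos_or_GL_neg:
  assumes "connected T" "T \<subseteq> GL"
  shows "T \<subseteq> GL_pos \<or> T \<subseteq> GL_neg"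
proof -
  have "T \<subseteq> GL_pos \<union> GL_neg" "GL_pos \<inter> GL_neg \<inter> T = {}"
    using assms(2) by (auto simp: GL_pos_eq_det GL_neg_eq_det GL_eq_det)
  then show ?thesis
    using connectedD[OF assms(1) open_GL_pos open_GL_neg] by blast
qed

lemma reflection_axis_in_GL_neg: "reflection (axis k 1) \<in> GL_neg"
  by (simp add: GL_neg_eq_det det_diagonal_unit flip: diagonal_unit_eq_reflection)

lemma GL_pos_neg_disjoint: "GL_pos \<inter> GL_neg = {}"
  by (auto simp: GL_pos_def GL_neg_def)

lemma connected_GL_pos: "connected (GL_pos :: (real^'n^'n) set)"
proof -
  have "connected_component GL_pos A (mat 1)" if A: "A \<in> GL_pos" for A :: "real^'n^'n"
  proof -
    have "A \<in> GL"
      using A by (simp add: GL_pos_def)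
    then obtain T B where T: "connected T" "T \<subseteq> GL" "A \<in> T" "B \<in> T"
      \<comment> \<open>Here \<open>undefined\<close> is merely some index; one exists because types
        are nonempty.\<close>
      and B: "B = mat 1 \<or> B = reflection (axis undefined 1)"
      using connected_component_GL_cases[of A undefined] by (auto simp: connected_component_def)
    have "T \<subseteq> GL_pos"
      using connected_subset_GL_pos_or_GL_neg[OF T(1,2)] T(3) A GL_pos_neg_disjoint by blast
    \<comment> \<open>The reflection has negative determinant, so it cannot lie in
      \<open>T\<close>.\<close>
    moreover have "B = mat 1"
      using B T(4) \<open>T \<subseteq> GL_pos\<close> reflection_axis_in_GL_neg GL_pos_neg_disjoint by blast
    ultimately show ?thesis
      using T by (auto simp: connected_component_def)
  qed
  then show ?thesis
    unfolding connected_iff_connected_component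
    by (blast intro: connected_component_trans connected_component_sym)
qed

lemma connected_GL_neg: "connected (GL_neg :: (real^'n^'n) set)"
proof -
  have mat_1: "(mat 1 :: real^'n^'n) \<in> GL_pos"
    by (simp add: GL_pos_eq_det)
  have "connected_component GL_neg A (reflection (axis undefined 1))" if A: "A \<in> GL_neg" for A :: "real^'n^'n"
  proof -
    have "A \<in> GL"
      using A by (simp add: GL_neg_def)
    then obtain T B where T: "connected T" "T \<subseteq> GL" "A \<in> T" "B \<in> T"
      and B: "B = mat 1 \<or> B = reflection (axis undefined 1)"
      using connected_component_GL_cases[of A undefined] by (auto simp: connected_component_def)
    have "T \<subseteq> GL_neg"
      using connected_subset_GL_pos_or_GL_neg[OF T(1,2)] T(3) A GL_pos_neg_disjoint by blast
    moreover have "B = reflection (axis undefined 1)"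
      using B T(4) \<open>T \<subseteq> GL_neg\<close> mat_1 GL_pos_neg_disjoint by blast
    ultimately show ?thesis
      using T by (auto simp: connected_component_def)
  qed
  then show ?thesis
    unfolding connected_iff_connected_component
    by (blast intro: connected_component_trans connected_component_sym)
qed

section \<open>Symmetric space structure\<close>

lemma semi_riemannian_symmetric_space_trace_metric:
  fixes M :: "(real^'n^'n) set"
  assumes "open M" "connected M" "M \<subseteq> GL"
    and sym: "\<And>A. A \<in> M \<Longrightarrow> symmetry_at M trace_metric A (psi A)"
  shows "semi_riemannian_symmetric_space M trace_metric"
  unfolding semi_riemannian_symmetric_space_def
proof (intro conjI ballI)
  show "semi_riemannian_manifold M trace_metric"
    using assms(1,3) by (rule semi_riemannian_manifold_trace_metric)
  fix A assume A: "A \<in> M"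
  \<comment> \<open>Any two symmetries at \<open>A\<close> share the value \<open>A\<close> and the
    differential -id there, which is the initial data for \<open>isometry_unique\<close>.\<close>
  have "f x = psi A x" if f: "symmetry_at M trace_metric A f" and x: "x \<in> M" for f x
    by (rule isometry_unique[OF assms(1-3) _ _ A _ _ x])
      (use f sym[OF A] in \<open>auto simp: symmetry_at_def\<close>)
  then show "\<exists>f. symmetry_at M trace_metric A f \<and>
      (\<forall>f'. symmetry_at M trace_metric A f' \<longrightarrow> (\<forall>x\<in>M. f' x = f x))"
    using sym[OF A] by blast
qed fact

theorem proposition1p2:
  shows
    "semi_riemannian_manifold (GL :: (real^'n^'n) set) trace_metric \<and>
     (\<forall>f \<in> compositions (basic_maps :: (real^'n^'n \<Rightarrow> real^'n^'n) set).
        isometry_of GL trace_metric f) \<and>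
     semi_riemannian_symmetric_space (GL_pos :: (real^'n^'n) set) trace_metric \<and>
     semi_riemannian_symmetric_space (GL_neg :: (real^'n^'n) set) trace_metric \<and>
     (\<forall>A \<in> (GL_pos :: (real^'n^'n) set). symmetry_at GL_pos trace_metric A (psi A)) \<and>
     (\<forall>A \<in> (GL_neg :: (real^'n^'n) set). symmetry_at GL_neg trace_metric A (psi A)) \<and>
     (\<forall>A \<in> (GL :: (real^'n^'n) set).
        psi A = left_translation A \<circ> right_translation A \<circ> matrix_inv) \<and>
     psi (mat 1 :: real^'n^'n) = matrix_inv"
proof (intro conjI ballI)
  show "semi_riemannian_manifold (GL :: (real^'n^'n) set) trace_metric"
    by (rule semi_riemannian_manifold_trace_metric[OF open_GL subset_refl])
  show "isometry_of GL trace_metric f" if "f \<in> compositions basic_maps" for f :: "real^'n^'n \<Rightarrow> real^'n^'n"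
    using that by induction (blast intro: isometry_basic_maps isometry_of_comp[OF open_GL])+
  show "semi_riemannian_symmetric_space (GL_pos :: (real^'n^'n) set) trace_metric"
    by (rule semi_riemannian_symmetric_space_trace_metric[OF open_GL_pos connected_GL_pos _
          symmetry_at_psi_GL_pos]) (auto simp: GL_pos_def)
  show "semi_riemannian_symmetric_space (GL_neg :: (real^'n^'n) set) trace_metric"
    by (rule semi_riemannian_symmetric_space_trace_metric[OF open_GL_neg connected_GL_neg _
          symmetry_at_psi_GL_neg]) (auto simp: GL_neg_def)
  show "psi A = left_translation A \<circ> right_translation A \<circ> matrix_inv" for A :: "real^'n^'n"
    by (simp add: fun_eq_iff psi_apply left_translation_def right_translation_def matrix_mul_assoc)
  show "psi (mat 1 :: real^'n^'n) = matrix_inv"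
    by (simp add: fun_eq_iff psi_apply)
qed (erule symmetry_at_psi_GL_pos symmetry_at_psi_GL_neg)+

end
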